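(* Let $X$ be an Asplund space, let $F\subset X$ be a nonempty closed bounded convex set with $0\in\operatorname{int}F$, and let $\Omega_1,\dots,\Omega_n$ be nonempty closed subsets of $X$. Let $\bar x\in X$ be a local optimal solution (local minimizer) of the generalized Fermat-Torricelli problem $$\text{minimize } T(x):=\sum_{i=1}^n T^F_{\Omega_i}(x),\quad x\in X,$$ such that for each $i=1,\dots,n$ the minimal time function $T^F_{\Omega_i}(\cdot)$ is well posed at $\bar x$ when $\bar x\notin\Omega_i$. Then $$0\in\sum_{i=1}^n A_i(\bar x),$$ where $$A_i(\bar x):=\bigcup_{\omega\in\Pi^F_{\Omega_i}(\bar x)}\big[-\partial\rho_F(\omega-\bar x)\cap N(\omega;\Omega_i)\big],\quad i=1,\dots,n.$$
   Context: A Banach space is Asplund if each of its separable subspaces has a separable dual. $X^*$ is the topological dual of $X$ with pairing $\langle\cdot,\cdot\rangle$. For a nonempty closed set $\Omega\subset X$, the minimal time function is $T^F_\Omega(x):=\inf\{t\ge 0 \mid \Omega\cap(x+tF)\ne\emptyset\}$, and the generalized projection is $\Pi^F_\Omega(x):=(x+T^F_\Omega(x)F)\cap\Omega$. The Minkowski gauge of $F$ is $\rho_F(x):=\inf\{t\ge 0\mid x\in tF\}$; it is convex, and $\partial\rho_F(u)=\{x^*\in X^*\mid \langle x^*,x-u\rangle\le\rho_F(x)-\rho_F(u)\ \forall x\in X\}$ is its subdifferential in the sense of convex analysis. Well-posedness: $T^F_\Omega$ is well posed at $\bar x\notin\Omega$ (with $T^F_\Omega(\bar x)<\infty$) if for any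 sequence $x_k\to\bar x$ with $T^F_\Omega(x_k)\to T^F_\Omega(\bar x)$ as $k\to\infty$ there is a sequence $w_k\in\Pi^F_\Omega(x_k)$ containing a convergent subsequence. Basic (limiting, Mordukhovich) normal cone: for $\varepsilon\ge0$ and $x\in\Omega$ let $$\widehat N_\varepsilon(x;\Omega):=\Big\{x^*\in X^*\ \Big|\ \limsup_{u\to x,\,u\in\Omega}\frac{\langle x^*,u-x\rangle}{\|u-x\|}\le\varepsilon\Big\},$$ and $\widehat N_\varepsilon(x;\Omega):=\emptyset$ if $x\notin\Omega$. Then $N(\bar x;\Omega)$ is the set of all $x^*\in X^*$ for which there are sequences $\varepsilon_k\downarrow0$, $x_k\to\bar x$ and $x_k^*\in\widehat N_{\varepsilon_k}(x_k;\Omega)$ with $x^*_k\to x^*$ in the weak$^*$ topology of $X^*$. The sum of sets is the Minkowski sum. When $\bar x\in\Omega_i$ one has $\Pi^F_{\Omega_i}(\bar x)=\{\bar x\}$ and $A_i(\bar x)=N(\bar x;\Omega_i)\cap C^*$ with $C^*:=\{x^*\in X^*\mid\sup_{x\in F}\langle -x^*,x\rangle\le1\}$. *)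

theory Defs
  imports "HOL-Analysis.Analysis"
begin

section \<open>Asplund spaces\<close>

text \<open>A linear subspace \<open>Y\<close> is a set rather than a type, so its topological dual is the set of
  bounded linear functionals on \<open>Y\<close>, extended by \<open>undefined\<close> outside \<open>Y\<close> in order that
  functionals agreeing on \<open>Y\<close> be equal.\<close>

definition subspace_dual :: "'a::real_normed_vector set \<Rightarrow> ('a \<Rightarrow> real) set" where
  "subspace_dual Y =
    {f \<in> extensional Y.
       (\<forall>x\<in>Y. \<forall>y\<in>Y. f (x + y) = f x + f y) \<and>
       (\<forall>c. \<forall>x\<in>Y. f (c *\<^sub>R x) = c * f x) \<and>
       (\<exists>K. \<forall>x\<in>Y. \<bar>f x\<bar> \<le> K * norm x)}"

text \<open>The distance of the dual norm, the supremum over the unit ball of \<open>Y\<close>. The value 0 outside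
  the dual only serves the locale \<^locale>\<open>Metric_space\<close>, which asks for
  nonnegativity everywhere.\<close>

definition subspace_dual_dist ::
    "'a::real_normed_vector set \<Rightarrow> ('a \<Rightarrow> real) \<Rightarrow> ('a \<Rightarrow> real) \<Rightarrow> real" where
  "subspace_dual_dist Y f g =
    (if f \<in> subspace_dual Y \<and> g \<in> subspace_dual Y
     then SUP y \<in> {y \<in> Y. norm y \<le> 1}. \<bar>f y - g y\<bar> else 0)"

lemma bdd_above_subspace_dual:
  assumes "f \<in> subspace_dual Y" "g \<in> subspace_dual Y"
  shows "bdd_above ((\<lambda>y. \<bar>f y - g y\<bar>) ` {y \<in> Y. norm y \<le> 1})"
proof -
  obtain K L where K: "\<And>x. x \<in> Y \<Longrightarrow> \<bar>f x\<bar> \<le> K * norm x"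
    and L: "\<And>x. x \<in> Y \<Longrightarrow> \<bar>g x\<bar> \<le> L * norm x"
    using assms unfolding subspace_dual_def by blast
  have "\<bar>f y - g y\<bar> \<le> \<bar>K\<bar> + \<bar>L\<bar>" if "y \<in> Y" "norm y \<le> 1" for y
  proof -
    have "K * norm y \<le> \<bar>K\<bar> * 1" "L * norm y \<le> \<bar>L\<bar> * 1"
      using that by (intro mult_mono; simp)+
    then show ?thesis using K[OF that(1)] L[OF that(1)] by linarith
  qed
  then show ?thesis by (intro bdd_aboveI[where M = "\<bar>K\<bar> + \<bar>L\<bar>"]) auto
qed

lemma Metric_space_subspace_dual:
  assumes Y: "subspace Y"
  shows "Metric_space (subspace_dual Y) (subspace_dual_dist Y)"
proof
  let ?B = "{y \<in> Y. norm y \<le> 1}"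
  have Y0: "0 \<in> ?B" using subspace_0[OF Y] by simp
  have upper: "\<bar>f y - g y\<bar> \<le> subspace_dual_dist Y f g"
    if "f \<in> subspace_dual Y" "g \<in> subspace_dual Y" "y \<in> ?B" for f g y
    using cSUP_upper[OF that(3) bdd_above_subspace_dual[OF that(1,2)]] that
    by (simp add: subspace_dual_dist_def)
  have least: "subspace_dual_dist Y f g \<le> M"
    if "f \<in> subspace_dual Y" "g \<in> subspace_dual Y" "\<And>y. y \<in> ?B \<Longrightarrow> \<bar>f y - g y\<bar> \<le> M" for f g M
  proof -
    have "(SUP y \<in> ?B. \<bar>f y - g y\<bar>) \<le> M"
      using Y0 that(3) by (intro cSUP_least) auto
    then show ?thesis using that(1,2) by (simp add: subspace_dual_dist_def)
  qed
  show nn: "0 \<le> subspace_dual_dist Y f g" for f g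
  proof (cases "f \<in> subspace_dual Y \<and> g \<in> subspace_dual Y")
    case True
    then show ?thesis using upper[of f g 0] Y0 by force
  qed (auto simp: subspace_dual_dist_def)
  show "subspace_dual_dist Y f g = subspace_dual_dist Y g f" for f g
    by (simp add: subspace_dual_dist_def abs_minus_commute conj_commute)
  show "subspace_dual_dist Y f g = 0 \<longleftrightarrow> f = g"
    if fg: "f \<in> subspace_dual Y" "g \<in> subspace_dual Y" for f g
  proof
    assume 0: "subspace_dual_dist Y f g = 0"
    have ball: "f y = g y" if "y \<in> ?B" for y
      using upper[OF fg that] 0 by simp
    have "f y = g y" if y: "y \<in> Y" for y
    proof (cases "y = 0")
      case True
      then show ?thesis using ball[OF Y0] by simp
    next
      case False
      have "(1 / norm y) *\<^sub>R y \<in> ?B"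
        using subspace_scale[OF Y y] False by simp
      from ball[OF this] have "(1 / norm y) * f y = (1 / norm y) * g y"
        using fg y unfolding subspace_dual_def by auto
      then show ?thesis using False by simp
    qed
    then show "f = g"
      using fg unfolding subspace_dual_def by (auto intro: extensionalityI)
  next
    assume "f = g"
    then show "subspace_dual_dist Y f g = 0"
      using least[of f g 0] nn[of f g] fg by simp
  qed
  show "subspace_dual_dist Y f h \<le> subspace_dual_dist Y f g + subspace_dual_dist Y g h"
    if "f \<in> subspace_dual Y" "g \<in> subspace_dual Y" "h \<in> subspace_dual Y" for f g h
  proof (rule least[OF that(1,3)])
    fix y assume "y \<in> ?B"
    then show "\<bar>f y - h y\<bar> \<le> subspace_dual_dist Y f g + subspace_dual_dist Y g h"
      using upper[OF that(1,2)] upper[OF that(2,3)] by force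
  qed
qed

definition asplund_space :: "'a::banach itself \<Rightarrow> bool" where
  "asplund_space _ \<longleftrightarrow>
    (\<forall>Y :: 'a set. subspace Y \<and> separable_space (top_of_set Y) \<longrightarrow>
       separable_space (Metric_space.mtopology (subspace_dual Y) (subspace_dual_dist Y)))"


section \<open>Minimal time function, projection and gauge\<close>

text \<open>\<^term>\<open>(+) x ` ((*\<^sub>R) t ` F)\<close> is the set \<open>x + t F\<close>. The infimum is taken over the reals; when
  0 is interior to \<open>F\<close> it ranges over a nonempty set by
  the two \<open>nonempty\<close> lemmas below, so the minimal time and the gauge are finite.\<close>

definition minimal_time :: "'a::real_normed_vector set \<Rightarrow> 'a set \<Rightarrow> 'a \<Rightarrow> real" where
  "minimal_time F \<Omega> x = Inf {t. 0 \<le> t \<and> \<Omega> \<inter> ((+) x ` ((*\<^sub>R) t ` F)) \<noteq> {}}"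

definition gen_projection :: "'a::real_normed_vector set \<Rightarrow> 'a set \<Rightarrow> 'a \<Rightarrow> 'a set" where
  "gen_projection F \<Omega> x = ((+) x ` ((*\<^sub>R) (minimal_time F \<Omega> x) ` F)) \<inter> \<Omega>"

definition minkowski_gauge :: "'a::real_normed_vector set \<Rightarrow> 'a \<Rightarrow> real" where
  "minkowski_gauge F x = Inf {t. 0 \<le> t \<and> x \<in> (*\<^sub>R) t ` F}"

lemma minkowski_gauge_nonempty:
  fixes F :: "'a::real_normed_vector set"
  assumes "0 \<in> interior F"
  shows "{t. 0 \<le> t \<and> x \<in> (*\<^sub>R) t ` F} \<noteq> {}"
proof -
  obtain e where e: "e > 0" "ball 0 e \<subseteq> F"
    using assms by (meson mem_interior)
  define t where "t = (norm x + 1) / e"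
  have t: "t > 0" using e by (simp add: t_def add_nonneg_pos)
  have "norm ((1 / t) *\<^sub>R x) = e * (norm x / (norm x + 1))"
    using e t by (simp add: t_def)
  also have "\<dots> < e * 1"
    using e by (intro mult_strict_left_mono) (auto simp: divide_less_eq add_nonneg_pos)
  finally have "(1 / t) *\<^sub>R x \<in> F" using e by auto
  moreover have "x = t *\<^sub>R ((1 / t) *\<^sub>R x)" using t by simp
  ultimately have "x \<in> (*\<^sub>R) t ` F" by blast
  then show ?thesis using t by (auto intro!: exI[of _ t])
qed

lemma minimal_time_nonempty:
  fixes F :: "'a::real_normed_vector set"
  assumes "0 \<in> interior F" "\<Omega> \<noteq> {}"
  shows "{t. 0 \<le> t \<and> \<Omega> \<inter> ((+) x ` ((*\<^sub>R) t ` F)) \<noteq> {}} \<noteq> {}"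
proof -
  obtain w where w: "w \<in> \<Omega>" using assms by blast
  obtain t where t: "0 \<le> t" "w - x \<in> (*\<^sub>R) t ` F"
    using minkowski_gauge_nonempty[OF assms(1), of "w - x"] by blast
  have "w \<in> (+) x ` ((*\<^sub>R) t ` F)"
    using imageI[OF t(2), of "(+) x"] by simp
  then show ?thesis using w t by blast
qed

definition well_posed_at :: "'a::real_normed_vector set \<Rightarrow> 'a set \<Rightarrow> 'a \<Rightarrow> bool" where
  "well_posed_at F \<Omega> x \<longleftrightarrow>
    (\<forall>xs. xs \<longlonglongrightarrow> x \<and> (\<lambda>k. minimal_time F \<Omega> (xs k)) \<longlonglongrightarrow> minimal_time F \<Omega> x \<longrightarrow>
       (\<exists>w. (\<forall>k. w k \<in> gen_projection F \<Omega> (xs k)) \<and>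
            (\<exists>r. strict_mono r \<and> convergent (w \<circ> r))))"


section \<open>Subdifferential and normal cones\<close>

text \<open>The dual \<open>X\<^sup>*\<close> of the whole space is \<^typ>\<open>'a \<Rightarrow>\<^sub>L real\<close>.\<close>

definition convex_subdifferential ::
    "('a::real_normed_vector \<Rightarrow> real) \<Rightarrow> 'a \<Rightarrow> ('a \<Rightarrow>\<^sub>L real) set" where
  "convex_subdifferential g u =
    {x'. \<forall>x. blinfun_apply x' (x - u) \<le> g x - g u}"

text \<open>The upper limit is extended-real valued: it is \<open>-\<infinity>\<close> when \<open>x\<close> is an isolated point of \<open>\<Omega>\<close>.\<close>

definition eps_normals ::
    "real \<Rightarrow> 'a::real_normed_vector \<Rightarrow> 'a set \<Rightarrow> ('a \<Rightarrow>\<^sub>L real) set" where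
  "eps_normals \<epsilon> x \<Omega> =
    (if x \<in> \<Omega> then
       {x'. Limsup (at x within \<Omega>)
              (\<lambda>u. ereal (blinfun_apply x' (u - x) / norm (u - x))) \<le> ereal \<epsilon>}
     else {})"

text \<open>For real-valued operators the library's strong operator topology, the topology of pointwise
  convergence, is the weak* topology.\<close>

abbreviation weak_star_topology :: "('a::real_normed_vector \<Rightarrow>\<^sub>L real) topology" where
  "weak_star_topology \<equiv> strong_operator_topology"

lemma limitin_weak_star_iff:
  "limitin weak_star_topology xs x' F \<longleftrightarrow>
    (\<forall>v. ((\<lambda>k. blinfun_apply (xs k) v) \<longlongrightarrow> blinfun_apply x' v) F)"
proof
  assume l: "limitin weak_star_topology xs x' F"
  show "\<forall>v. ((\<lambda>k. blinfun_apply (xs k) v) \<longlongrightarrow> blinfun_apply x' v) F"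
  proof
    fix v
    show "((\<lambda>k. blinfun_apply (xs k) v) \<longlongrightarrow> blinfun_apply x' v) F"
      using continuous_map_limit[OF strong_operator_topology_continuous_evaluation[of v] l]
      by (simp add: o_def)
  qed
next
  assume *: "\<forall>v. ((\<lambda>k. blinfun_apply (xs k) v) \<longlongrightarrow> blinfun_apply x' v) F"
  have "limitin (product_topology (\<lambda>_. euclidean) UNIV) (\<lambda>k. blinfun_apply (xs k)) (blinfun_apply x') F"
    using * by (simp add: limitin_componentwise)
  then have lim: "limitin euclidean (\<lambda>k. blinfun_apply (xs k)) (blinfun_apply x') F"
    by (simp add: euclidean_product_topology)
  show "limitin weak_star_topology xs x' F"
    unfolding limitin_def
  proof (intro conjI allI impI)
    fix U assume "openin weak_star_topology U \<and> x' \<in> U"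
    then obtain V where V: "open V" "U = blinfun_apply -` V" "blinfun_apply x' \<in> V"
      unfolding strong_operator_topology_def openin_pullback_topology by auto
    then show "eventually (\<lambda>k. xs k \<in> U) F"
      using lim unfolding limitin_def by auto
  qed (simp add: strong_operator_topology_topspace)
qed

text \<open>A decreasing sequence with limit 0 is nonnegative.\<close>

definition normal_cone :: "'a::real_normed_vector \<Rightarrow> 'a set \<Rightarrow> ('a \<Rightarrow>\<^sub>L real) set" where
  "normal_cone x \<Omega> =
    {x'. \<exists>\<epsilon> xs xs'. decseq \<epsilon> \<and> \<epsilon> \<longlonglongrightarrow> 0 \<and> xs \<longlonglongrightarrow> x \<and>
           (\<forall>k. xs' k \<in> eps_normals (\<epsilon> k) (xs k) \<Omega>) \<and>
           limitin weak_star_topology xs' x' sequentially}"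


section \<open>The generalized Fermat-Torricelli problem\<close>

definition local_minimizer :: "('a::metric_space \<Rightarrow> real) \<Rightarrow> 'a \<Rightarrow> bool" where
  "local_minimizer g x \<longleftrightarrow> (\<exists>\<delta>>0. \<forall>y\<in>ball x \<delta>. g x \<le> g y)"

text \<open>The pointwise negative of a set is written \<^term>\<open>uminus ` S\<close>, since \<^term>\<open>- S\<close> is the
  complement. Sums of sets, on the other hand, are Minkowski sums (\<open>Set_Algebras\<close>).\<close>

definition FT_set :: "'a::real_normed_vector set \<Rightarrow> 'a set \<Rightarrow> 'a \<Rightarrow> ('a \<Rightarrow>\<^sub>L real) set" where
  "FT_set F \<Omega> x =
    (\<Union>\<omega> \<in> gen_projection F \<Omega> x.
       uminus ` convex_subdifferential (minkowski_gauge F) (\<omega> - x) \<inter> normal_cone \<omega> \<Omega>)"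

end

theory Submission
  imports Defs "HOL-Library.Diagonal_Subsequence"
begin

text \<open>Write \<open>\<rho>\<close> for the Minkowski gauge of \<open>F\<close>. It is sublinear, bounded by a multiple of the norm, and
  \<open>\<rho>(w) = max {f w | f \<in> K}\<close>, where the polar \<open>K\<close> of \<open>F\<close> consists of the linear functionals below
  \<open>\<rho>\<close>. The projection sets \<open>\<Pi>\<^sub>i(xbar)\<close> are nonempty: they contain \<open>xbar\<close> if \<open>xbar \<in> \<Omega>\<^sub>i\<close>, and
  otherwise well-posedness applies to the constant sequence \<open>xbar\<close>. Choose \<open>\<omega>\<^sub>i \<in> \<Pi>\<^sub>i(xbar)\<close>.
  Since \<open>T\<^sub>i(x) \<le> \<rho>(u - x)\<close> for
  all \<open>u \<in> \<Omega>\<^sub>i\<close>, with equality at \<open>x = xbar\<close>, \<open>u = \<omega>\<^sub>i\<close>, the tuple \<open>(xbar, \<omega>\<^sub>1, \<dots>, \<omega>\<^sub>n)\<close> minimizes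
  \<open>\<Sum>\<^sub>i \<rho>(u\<^sub>i - x)\<close> over \<open>u\<^sub>i \<in> \<Omega>\<^sub>i\<close> and \<open>x\<close> near \<open>xbar\<close>. The minimal time functions are
  thereby replaced by one explicit convex function under closed constraints, and the necessary
  conditions for this problem give the result.

  If \<open>\<rho>\<close> were Frechet differentiable, Ekeland's principle would suffice: a minimizer up to a
  perturbation \<open>\<epsilon> * norm\<close> yields derivatives \<open>f\<^sub>i\<close> with \<open>norm (\<Sum>\<^sub>i f\<^sub>i) \<le> \<epsilon>\<close> (vary \<open>x\<close>) and \<open>- f\<^sub>i\<close> an
  \<open>\<epsilon>\<close>-normal of \<open>\<Omega>\<^sub>i\<close> at \<open>u\<^sub>i\<close> (vary \<open>u\<^sub>i\<close>). In general three devices replace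
  differentiability; the Asplund property enters the first and the third.

  \<^item> Smoothing (\<open>smooth_approximation\<close>). On a separable subspace \<open>Y\<close> the polar has a countable
    subset \<open>{b\<^sub>i}\<close> that is dense for the norm of \<open>Y\<^sup>*\<close>. The function
    \<open>R(w) = max {f w - \<kappa> * (\<Sum>\<^sub>i 2\<^sup>-\<^sup>i * norm (f - b\<^sub>i)\<^sup>2) | f \<in> K}\<close> is uniformly close to \<open>\<rho>\<close>, and the penalty
    makes near-maximizers at \<open>w\<close> norm-close on \<open>Y\<close> to the maximizer, so that \<open>R\<close> is Frechet
    differentiable along \<open>Y\<close> everywhere.
  \<^item> Separable reduction (\<open>separable_closing\<close>). Multipliers found by testing with vectors of \<open>Y\<close>
    need not work in the whole space. By weak* compactness of \<open>K\<close>, multipliers fail to exist only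
    because of finitely many test vectors, and \<open>Y\<close> is built so as to contain such test vectors
    for a dense set of base points.
  \<^item> Sequential weak* compactness of \<open>K\<close> (\<open>dominated_convergent_subsequence\<close>). A sequence without a
    convergent subsequence splits again and again along a binary tree, and the branches yield
    uncountably many functionals that are uniformly separated on one separable subspace.

  With \<open>\<epsilon> = 1 / k\<close> and a weak* convergent subsequence of the multipliers, the limits \<open>g\<^sub>i\<close> sum to 0, attain
  \<open>\<rho>\<close> at \<open>\<omega>\<^sub>i - xbar\<close>, hence are subgradients there, and \<open>- g\<^sub>i\<close> is a limiting normal at \<open>\<omega>\<^sub>i\<close>.\<close>

section \<open>Sublinear functionals and their linear minorants\<close>

definition sublinear :: "('a::real_vector \<Rightarrow> real) \<Rightarrow> bool" where
  "sublinear p \<longleftrightarrow>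
    (\<forall>x y. p (x + y) \<le> p x + p y) \<and> (\<forall>t x. 0 \<le> t \<longrightarrow> p (t *\<^sub>R x) = t * p x)"

lemma sublinearI:
  assumes "\<And>x y. p (x + y) \<le> p x + p y" "\<And>t x. 0 < t \<Longrightarrow> p (t *\<^sub>R x) \<le> t * p x" "p 0 = 0"
  shows "sublinear p"
  unfolding sublinear_def
proof (intro conjI allI impI assms(1))
  fix t :: real and x :: 'a
  assume t: "0 \<le> t"
  show "p (t *\<^sub>R x) = t * p x"
  proof (cases "t = 0")
    case False
    with t have t: "0 < t" by simp
    have "p x \<le> (1 / t) * p (t *\<^sub>R x)" using assms(2)[of "1 / t" "t *\<^sub>R x"] t by simp
    then have "t * p x \<le> p (t *\<^sub>R x)" using t by (simp add: field_simps)
    then show ?thesis using assms(2)[OF t, of x] by simp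
  qed (simp add: assms(3))
qed

lemma sublinear_add: "sublinear p \<Longrightarrow> p (x + y) \<le> p x + p y"
  by (simp add: sublinear_def)

lemma sublinear_scaleR: "sublinear p \<Longrightarrow> 0 \<le> t \<Longrightarrow> p (t *\<^sub>R x) = t * p x"
  by (simp add: sublinear_def)

lemma sublinear_zero: "sublinear p \<Longrightarrow> p 0 = 0"
  using sublinear_scaleR[of p 0 0] by simp

lemma sublinear_ge_uminus: "sublinear p \<Longrightarrow> - p (- x) \<le> p x"
  using sublinear_add[of p x "- x"] sublinear_zero[of p] by simp

text \<open>The witness is the infimum of \<open>p (x + t *\<^sub>R a) - t * p a\<close> over \<open>t \<ge> 0\<close>. It serves twice: a minimal
  sublinear functional equals all its lowerings and is therefore additive, and lowering \<open>p\<close> in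
  direction \<open>a\<close> forces the linear minorants of the result to agree with \<open>p\<close> at \<open>a\<close>.\<close>

lemma sublinear_lower:
  fixes p :: "'a::real_vector \<Rightarrow> real" and a :: 'a
  assumes p: "sublinear p"
  obtains q where "sublinear q" "\<And>x. q x \<le> p x" "\<And>x. q x \<le> p (x + a) - p a"
proof -
  define q where "q = (\<lambda>x. INF t\<in>{0..}. p (x + t *\<^sub>R a) - t * p a)"
  have lb: "- p (- x) \<le> p (x + t *\<^sub>R a) - t * p a" if "0 \<le> t" for t x
    using sublinear_add[OF p, of "x + t *\<^sub>R a" "- x"] sublinear_scaleR[OF p that, of a] by simp
  have bdd: "bdd_below ((\<lambda>t. p (x + t *\<^sub>R a) - t * p a) ` {0..})" for x
    using lb by (intro bdd_belowI2[where m = "- p (- x)"]) auto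
  have low: "q x \<le> p (x + t *\<^sub>R a) - t * p a" if "0 \<le> t" for t x
    unfolding q_def using that by (intro cINF_lower[OF bdd]) auto
  have great: "c \<le> q x" if "\<And>t. 0 \<le> t \<Longrightarrow> c \<le> p (x + t *\<^sub>R a) - t * p a" for c x
    unfolding q_def using that by (intro cINF_greatest) auto
  have qp: "q x \<le> p x" for x using low[of 0 x] by simp
  have qa: "q x \<le> p (x + a) - p a" for x using low[of 1 x] by simp
  have "sublinear q"
  proof (rule sublinearI)
    fix x y
    have "q (x + y) - (p (x + s *\<^sub>R a) - s * p a) \<le> p (y + t *\<^sub>R a) - t * p a"
      if "0 \<le> s" "0 \<le> t" for s t
    proof -
      have "q (x + y) \<le> p ((x + s *\<^sub>R a) + (y + t *\<^sub>R a)) - (s + t) * p a"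
        using low[of "s + t" "x + y"] that by (simp add: algebra_simps)
      also have "\<dots> \<le> p (x + s *\<^sub>R a) + p (y + t *\<^sub>R a) - (s + t) * p a"
        using sublinear_add[OF p] by simp
      finally show ?thesis by (simp add: algebra_simps)
    qed
    then have "q (x + y) - (p (x + s *\<^sub>R a) - s * p a) \<le> q y" if "0 \<le> s" for s
      using that by (intro great)
    then have "q (x + y) - q y \<le> q x"
      by (intro great) (simp add: algebra_simps)
    then show "q (x + y) \<le> q x + q y" by simp
  next
    fix t :: real and x :: 'a
    assume t: "0 < t"
    have "q (t *\<^sub>R x) / t \<le> q x"
    proof (rule great)
      fix s :: real assume s: "0 \<le> s"
      have "q (t *\<^sub>R x) \<le> p (t *\<^sub>R (x + s *\<^sub>R a)) - t * s * p a"
        using low[of "t * s" "t *\<^sub>R x"] s t by (simp add: algebra_simps)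
      also have "\<dots> = t * p (x + s *\<^sub>R a) - t * s * p a"
        using sublinear_scaleR[OF p, of t "x + s *\<^sub>R a"] t by simp
      also have "\<dots> = t * (p (x + s *\<^sub>R a) - s * p a)"
        by (simp add: right_diff_distrib)
      finally show "q (t *\<^sub>R x) / t \<le> p (x + s *\<^sub>R a) - s * p a" 
        using t by (simp add: field_simps)
    qed
    then show "q (t *\<^sub>R x) \<le> t * q x" using t by (simp add: field_simps)
  next
    show "q 0 = 0"
      using qp[of 0] great[of 0 0] sublinear_scaleR[OF p, of _ a] sublinear_zero[OF p] by force
  qed
  then show thesis using that qp qa by blast
qed

text \<open>The linear functionals are plain functions, so that the set carries the topology of pointwise
  convergence of the function space, which is the weak* topology. For the Minkowski gauge of \<open>F\<close>
  this set is the polar of \<open>F\<close>, that is, \<open>\<partial>\<rho>\<^sub>F(0)\<close>.\<close>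

definition dominated :: "('a::real_vector \<Rightarrow> real) \<Rightarrow> ('a \<Rightarrow> real) set" where
  "dominated p = {f. linear f \<and> (\<forall>x. f x \<le> p x)}"

text \<open>The Hahn-Banach theorem in the form of Zorn's lemma for the pointwise order on the sublinear
  functionals below \<open>p\<close>: a chain has its pointwise infimum as lower bound, which is finite because
  every sublinear \<open>f \<le> p\<close> satisfies \<open>- p (- x) \<le> f x\<close>.\<close>

lemma dominated_nonempty:
  fixes p :: "'a::real_vector \<Rightarrow> real"
  assumes p: "sublinear p"
  shows "dominated p \<noteq> {}"
proof -
  define A where "A = {q. sublinear q \<and> (\<forall>x. q x \<le> p x)}"
  define P where "P = (\<lambda>f g :: 'a \<Rightarrow> real. \<forall>x. g x \<le> f x)"
  have "\<exists>m\<in>A. \<forall>a\<in>A. P m a \<longrightarrow> a = m"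
  proof (rule predicate_Zorn)
    show "partial_order_on A (relation_of P A)"
      by (rule partial_order_on_relation_ofI)
        (auto simp: P_def fun_eq_iff intro: order_trans antisym)
  next
    fix C assume "C \<in> Chains (relation_of P A)"
    then have CA: "C \<subseteq> A" and chain: "\<And>f g. f \<in> C \<Longrightarrow> g \<in> C \<Longrightarrow> P f g \<or> P g f"
      unfolding Chains_def relation_of_def by auto
    show "\<exists>u\<in>A. \<forall>a\<in>C. P a u"
    proof (cases "C = {}")
      case True
      then show ?thesis using p by (auto simp: A_def)
    next
      case False
      define u where "u = (\<lambda>x. INF f\<in>C. f x)"
      have lb: "- p (- x) \<le> f x" if "f \<in> C" for f x
      proof -
        have "sublinear f" "f (- x) \<le> p (- x)" using that CA unfolding A_def by auto
        then show ?thesis using sublinear_ge_uminus[of f x] by linarith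
      qed
      have low: "u x \<le> f x" if "f \<in> C" for f x
        unfolding u_def using that lb
        by (intro cINF_lower bdd_belowI2[where m = "- p (- x)"]) auto
      have great: "c \<le> u x" if "\<And>f. f \<in> C \<Longrightarrow> c \<le> f x" for c x
        unfolding u_def using that False by (intro cINF_greatest) auto
      have sub: "sublinear f" if "f \<in> C" for f using that CA by (auto simp: A_def)
      have "sublinear u"
      proof (rule sublinearI)
        fix x y
        have *: "u (x + y) \<le> f x + g y" if fg: "f \<in> C" "g \<in> C" for f g
        proof -
          obtain k where "k \<in> C" "k x \<le> f x" "k y \<le> g y"
            using chain[OF fg] fg unfolding P_def by auto
          then show ?thesis using low[of k "x + y"] sublinear_add[OF sub, of k x y] by simp
        qed
        have "u (x + y) - f x \<le> u y" if "f \<in> C" for f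
          using *[OF that] by (intro great) (simp add: algebra_simps)
        then have "u (x + y) - u y \<le> u x"
          by (intro great) (simp add: algebra_simps)
        then show "u (x + y) \<le> u x + u y" by simp
      next
        fix t :: real and x :: 'a
        assume t: "0 < t"
        have "u (t *\<^sub>R x) / t \<le> u x"
        proof (rule great)
          fix f assume f: "f \<in> C"
          show "u (t *\<^sub>R x) / t \<le> f x"
            using low[OF f, of "t *\<^sub>R x"] sublinear_scaleR[OF sub[OF f], of t x] t
            by (simp add: field_simps)
        qed
        then show "u (t *\<^sub>R x) \<le> t * u x" using t by (simp add: field_simps)
      next
        show "u 0 = 0"
          using False sublinear_zero[OF sub] low[of _ 0] great[of 0 0] by (force intro: antisym)
      qed
      moreover have "u x \<le> p x" for x
      proof -
        obtain f where "f \<in> C" using False by blast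
        then have "f x \<le> p x" using CA by (auto simp: A_def)
        then show ?thesis using low[OF \<open>f \<in> C\<close>, of x] by simp
      qed
      ultimately show ?thesis using low by (auto simp: A_def P_def)
    qed
  qed
  then obtain m where m: "m \<in> A" and minimal: "\<And>a. a \<in> A \<Longrightarrow> P m a \<Longrightarrow> a = m" by blast
  have sm: "sublinear m" and mp: "\<And>x. m x \<le> p x" using m by (auto simp: A_def)
  have add: "m (x + a) = m x + m a" for x a
  proof -
    obtain q where q: "sublinear q" "\<And>x. q x \<le> m x" "\<And>x. q x \<le> m (x + a) - m a"
      by (rule sublinear_lower[OF sm, where a = a]) (rule that)
    have "q \<in> A" using q(1,2) mp unfolding A_def by (blast intro: order_trans)
    moreover have "P m q" using q(2) by (auto simp: P_def)
    ultimately have "q = m" by (rule minimal)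
    then show ?thesis using q(3)[of x] sublinear_add[OF sm, of x a] by simp
  qed
  have neg: "m (- x) = - m x" for x
    using add[of x "- x"] sublinear_zero[OF sm] by simp
  have "linear m"
  proof (rule linearI)
    fix r :: real and x
    show "m (r *\<^sub>R x) = r *\<^sub>R m x"
    proof (cases "0 \<le> r")
      case True
      then show ?thesis using sublinear_scaleR[OF sm] by simp
    next
      case False
      then show ?thesis
        using sublinear_scaleR[OF sm, of "- r" x] neg[of "r *\<^sub>R x"] by simp
    qed
  qed (rule add)
  then show ?thesis using mp by (auto simp: dominated_def)
qed

lemma dominated_attains:
  assumes p: "sublinear p"
  obtains f where "f \<in> dominated p" "f w = p w"
proof -
  obtain q where q: "sublinear q" "\<And>x. q x \<le> p x" "\<And>x. q x \<le> p (x + w) - p w"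
    by (rule sublinear_lower[OF p, where a = w]) (rule that)
  obtain f where f: "linear f" "\<And>x. f x \<le> q x"
    using dominated_nonempty[OF q(1)] by (auto simp: dominated_def)
  have "f (- w) \<le> - p w"
    using f(2)[of "- w"] q(3)[of "- w"] sublinear_zero[OF p] by simp
  then have "p w \<le> f w" using linear_neg[OF f(1), of w] by simp
  moreover have "f x \<le> p x" for x using f(2)[of x] q(2)[of x] by simp
  ultimately show thesis using that[of f] f(1) by (auto simp: dominated_def intro: antisym)
qed

lemma dominated_abs_le:
  fixes p :: "'a::real_normed_vector \<Rightarrow> real"
  assumes "f \<in> dominated p" "\<And>x. p x \<le> L * norm x"
  shows "\<bar>f x\<bar> \<le> L * norm x"
proof -
  have "linear f" and le: "\<And>x. f x \<le> p x" using assms(1) by (auto simp: dominated_def)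
  then have "f (- x) = - f x" by (simp add: linear_neg)
  then show ?thesis using le[of x] le[of "- x"] assms(2)[of x] assms(2)[of "- x"] by simp
qed

lemma compact_PiE_UNIV:
  fixes S :: "'i \<Rightarrow> 'b::topological_space set"
  assumes "\<And>i. compact (S i)"
  shows "compact (PiE UNIV S)"
proof -
  have "compactin (product_topology (\<lambda>i. euclidean) UNIV) (PiE UNIV S)"
    using assms by (subst compactin_PiE) auto
  then show ?thesis by (simp add: euclidean_product_topology)
qed

text \<open>Banach-Alaoglu: the set is closed in the product of the intervals \<open>[- p (- x), p x]\<close>.\<close>

lemma compact_dominated: "compact (dominated (p :: 'a::real_vector \<Rightarrow> real))"
proof -
  have "compact (PiE UNIV (\<lambda>x. {- p (- x) .. p x}))"
    by (rule compact_PiE_UNIV) simp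
  moreover have "closed {f :: 'a \<Rightarrow> real. linear f}"
  proof -
    have "{f :: 'a \<Rightarrow> real. linear f} =
        {f. \<forall>x y. f (x + y) = f x + f y} \<inter> {f. \<forall>r x. f (r *\<^sub>R x) = r * f x}"
      by (auto simp: linear_iff)
    also have "closed \<dots>"
      by (intro closed_Int closed_Collect_all closed_Collect_eq continuous_intros
          continuous_on_product_coordinates)
    finally show ?thesis .
  qed
  ultimately have "compact (PiE UNIV (\<lambda>x. {- p (- x) .. p x}) \<inter> {f. linear f})"
    by (rule compact_Int_closed)
  moreover have "PiE UNIV (\<lambda>x. {- p (- x) .. p x}) \<inter> {f. linear f} = dominated p"
  proof -
    have "- p (- x) \<le> f x" if "linear f" "\<forall>x. f x \<le> p x" for f x
      using spec[OF that(2), of "- x"] linear_neg[OF that(1), of x] by linarith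
    then show ?thesis by (auto simp only: dominated_def PiE_UNIV_domain Pi_iff atLeastAtMost_iff)
  qed
  ultimately show ?thesis by simp
qed

section \<open>Separable subspaces of an Asplund space\<close>

text \<open>The form in which the Asplund property is used below: the dual of \<open>Y\<close> is separable, so every set
  of functionals is norm-separable on \<open>Y\<close>.\<close>

lemma separable_dual_dense_subset:
  fixes Y :: "'a::banach set" and A :: "('a \<Rightarrow> real) set"
  assumes "asplund_space TYPE('a)" and Y: "subspace Y" "separable_space (top_of_set Y)"
    and A: "\<And>f. f \<in> A \<Longrightarrow> linear f" "\<And>f. f \<in> A \<Longrightarrow> \<exists>L. \<forall>x. \<bar>f x\<bar> \<le> L * norm x"
  obtains B where "countable B" "B \<subseteq> A"
    "\<And>f e. f \<in> A \<Longrightarrow> 0 < e \<Longrightarrow> \<exists>g\<in>B. \<forall>y\<in>Y. \<bar>f y - g y\<bar> \<le> e * norm y"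
proof -
  let ?S = "subspace_dual Y" and ?d = "subspace_dual_dist Y"
  interpret M: Metric_space ?S ?d by (rule Metric_space_subspace_dual[OF Y(1)])
  obtain C where C: "countable C" "C \<subseteq> ?S" and dense: "M.mtopology closure_of C = ?S"
    using assms(1) Y unfolding asplund_space_def separable_space_def by auto
  have R: "restrict f Y \<in> ?S" if "f \<in> A" for f
    using A[OF that] subspace_add[OF Y(1)] subspace_scale[OF Y(1)]
    by (auto simp: subspace_dual_def linear_add linear_scale)
  have bound: "\<bar>u y - v y\<bar> \<le> e * norm y"
    if "u \<in> ?S" "v \<in> ?S" "?d u v \<le> e" "y \<in> Y" for u v e y
  proof (cases "y = 0")
    case True
    then have "y = 0 *\<^sub>R y" by simp
    then have "u y = 0" "v y = 0"
      using that(1,2,4) unfolding subspace_dual_def by (metis (mono_tags, lifting) mem_Collect_eq mult_zero_left)+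
    then show ?thesis using True by simp
  next
    case False
    let ?y = "(1 / norm y) *\<^sub>R y"
    have y: "?y \<in> {y \<in> Y. norm y \<le> 1}" using False that(4) subspace_scale[OF Y(1)] by simp
    have "\<bar>u ?y - v ?y\<bar> \<le> ?d u v"
      using cSUP_upper[OF y bdd_above_subspace_dual[OF that(1,2)]] that(1,2)
      by (simp add: subspace_dual_dist_def)
    moreover have "u ?y = (1 / norm y) * u y" "v ?y = (1 / norm y) * v y"
      using that(1,2,4) unfolding subspace_dual_def by auto
    ultimately have "\<bar>(u y - v y) / norm y\<bar> \<le> e" using that(3) by (simp add: diff_divide_distrib)
    then show ?thesis using False by (simp add: abs_divide divide_le_eq)
  qed
  define ok where "ok c m f \<longleftrightarrow> f \<in> A \<and> ?d c (restrict f Y) < 1 / real (Suc m)" for c m f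
  define g where "g = (\<lambda>(c, m). SOME f. ok c m f)"
  define B where "B = g ` {(c, m). c \<in> C \<and> (\<exists>f. ok c m f)}"
  have g: "ok c m (g (c, m))" if "ok c m f" for c m f
    using that unfolding g_def by (simp only: prod.case someI[of "ok c m" f])
  show thesis
  proof
    have "countable (C \<times> (UNIV :: nat set))" using C(1) by simp
    then have "countable {(c, m :: nat). c \<in> C \<and> (\<exists>f. ok c m f)}"
      by (rule countable_subset[rotated]) auto
    then show "countable B" unfolding B_def by (rule countable_image)
    show "B \<subseteq> A" unfolding B_def using g ok_def by blast
    fix f and e :: real assume f: "f \<in> A" and e: "0 < e"
    obtain m where m: "1 / real (Suc m) < e / 2"
      using nat_approx_posE[of "e / 2"] e by (metis half_gt_zero)
    have "restrict f Y \<in> M.mtopology closure_of C" using R[OF f] dense by simp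
    then obtain c where c: "c \<in> C" "?d (restrict f Y) c < 1 / real (Suc m)"
      unfolding M.metric_closure_of by (auto simp: M.in_mball)
        (metis of_nat_0_less_iff zero_less_Suc of_nat_Suc zero_less_divide_1_iff)
    have "?d c (restrict f Y) < 1 / real (Suc m)" using c(2) by (simp add: M.commute)
    then have "ok c m f" using f by (simp add: ok_def)
    then have ok: "ok c m (g (c, m))" and gB: "g (c, m) \<in> B"
      using g c(1) by (auto simp: B_def)
    have gA: "g (c, m) \<in> A" using ok by (simp add: ok_def)
    have "?d (restrict f Y) (restrict (g (c, m)) Y) \<le> e"
      using M.triangle[OF R[OF f] _ R[OF gA], of c] c C(2) ok m by (auto simp: ok_def)
    then have "\<forall>y\<in>Y. \<bar>f y - g (c, m) y\<bar> \<le> e * norm y"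
      using bound[OF R[OF f] R[OF gA]] by (auto cong: restrict_apply)
    then show "\<exists>g\<in>B. \<forall>y\<in>Y. \<bar>f y - g y\<bar> \<le> e * norm y" using gB by blast
  qed
qed

text \<open>Separable reduction. Read \<open>P m z s U\<close> as: some condition with parameter \<open>m\<close> can be met at the
  tuple \<open>z\<close> with slack \<open>s\<close>, as far as the test vectors in \<open>U\<close> can tell. For every tuple \<open>z\<close> from the
  countable set \<open>D\<close> under construction and every slack \<open>1 / (j + 1)\<close> for which a finite test set
  defeats the condition, one such set is added to \<open>D\<close>. Then the closure of \<open>D\<close> contains enough test
  vectors for its own tuples too: moving from \<open>z\<close> to a nearby tuple of \<open>D\<close> and back costs only
  slack.\<close>

lemma separable_closing:
  fixes P :: "nat \<Rightarrow> (nat \<Rightarrow> 'a::real_normed_vector) \<Rightarrow> real \<Rightarrow> 'a set \<Rightarrow> bool"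
    and n :: nat and C :: real
  assumes D0: "countable D0" and C: "0 \<le> C"
    and lip: "\<And>m z z' s t U. P m z s U \<Longrightarrow> s + C * (\<Sum>i\<le>n. norm (z i - z' i)) \<le> t \<Longrightarrow> P m z' t U"
  obtains Y where "subspace Y" "closed Y" "separable_space (top_of_set Y)" "D0 \<subseteq> Y"
    "\<And>m z s U. \<forall>i\<le>n. z i \<in> Y \<Longrightarrow> \<forall>s>0. \<forall>U. finite U \<and> U \<subseteq> Y \<longrightarrow> P m z s U \<Longrightarrow>
        0 < s \<Longrightarrow> finite U \<Longrightarrow> P m z s U"
proof -
  define bad where "bad m j z U \<longleftrightarrow> finite U \<and> \<not> P m z (1 / real (Suc j)) U" for m j z U
  define W where "W m j z = (if \<exists>U. bad m j z U then SOME U. bad m j z U else {})" for m j z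
  have W: "bad m j z (W m j z)" if "bad m j z U" for m j z U
    using that unfolding W_def by (auto intro: someI)
  have finW: "finite (W m j z)" for m j z
  proof (cases "\<exists>U. bad m j z U")
    case True
    then show ?thesis using W bad_def by blast
  qed (simp add: W_def)
  \<comment> \<open>rational combinations make the closure of the final set a subspace\<close>
  define T where "T D = D \<union> (\<lambda>(q, x, y). q *\<^sub>R x + y) ` (\<rat> \<times> D \<times> D) \<union>
     (\<Union>(m, j, z) \<in> UNIV \<times> UNIV \<times> (PiE {..n} (\<lambda>_. D)). W m j z)" for D
  define E where "E k = (T ^^ k) (insert 0 D0)" for k
  define D where "D = (\<Union>k. E k)"
  have E_Suc: "E (Suc k) = T (E k)" for k by (simp add: E_def)
  have countE: "countable (E k)" for k
  proof (induction k)
    case 0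
    then show ?case using D0 by (simp add: E_def)
  next
    case (Suc k)
    have "countable (PiE {..n} (\<lambda>_. E k))" using Suc by (intro countable_PiE) auto
    moreover have "countable (W m j z)" for m j z using finW by (rule countable_finite)
    ultimately show ?case
      unfolding E_Suc T_def using Suc
      by (intro countable_Un countable_UN countable_image countable_SIGMA countable_rat) auto
  qed
  then have countD: "countable D" by (simp add: D_def)
  have "E k \<subseteq> E (Suc k)" for k by (auto simp: E_Suc T_def)
  then have incE: "E j \<subseteq> E k" if "j \<le> k" for j k using that by (rule lift_Suc_mono_le)
  have ED: "E k \<subseteq> D" for k by (auto simp: D_def)
  have D0D: "insert 0 D0 \<subseteq> D" using ED[of 0] by (simp add: E_def)
  have comb: "q *\<^sub>R x + y \<in> D" if "q \<in> \<rat>" "x \<in> D" "y \<in> D" for q x y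
  proof -
    obtain j k where "x \<in> E j" "y \<in> E k" using \<open>x \<in> D\<close> \<open>y \<in> D\<close> by (auto simp: D_def)
    then have "x \<in> E (max j k)" "y \<in> E (max j k)"
      using incE[of j "max j k"] incE[of k "max j k"] by auto
    then have "q *\<^sub>R x + y \<in> T (E (max j k))" unfolding T_def using that(1) by force
    then show ?thesis using ED[of "Suc (max j k)"] by (auto simp: E_Suc)
  qed
  have WD: "W m j z \<subseteq> D" if z: "z \<in> PiE {..n} (\<lambda>_. D)" for m j z
  proof -
    have "\<forall>i\<in>{..n}. \<exists>k. z i \<in> E k" using z by (auto simp: D_def)
    then obtain k where k: "\<And>i. i \<le> n \<Longrightarrow> z i \<in> E (k i)" by (metis atMost_iff)
    define K where "K = Max (k ` {..n})"
    have "z i \<in> E K" if "i \<le> n" for i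
      using k[OF that] incE[of "k i" K] that by (auto simp: K_def)
    then have "z \<in> PiE {..n} (\<lambda>_. E K)" using z by (auto simp: PiE_iff)
    then have "W m j z \<subseteq> T (E K)" unfolding T_def by blast
    then show ?thesis using ED[of "Suc K"] by (auto simp: E_Suc)
  qed
  define Y where "Y = closure D"
  have DY: "D \<subseteq> Y" by (simp add: Y_def closure_subset)
  have combY: "c *\<^sub>R x + y \<in> Y" if "x \<in> Y" "y \<in> Y" for c x y
  proof -
    obtain xs ys where xs: "\<And>k. xs k \<in> D" "xs \<longlonglongrightarrow> x" and ys: "\<And>k. ys k \<in> D" "ys \<longlonglongrightarrow> y"
      using \<open>x \<in> Y\<close> \<open>y \<in> Y\<close> unfolding Y_def closure_sequential by blast
    have "c \<in> closure \<rat>" by (simp add: Rats_closure_real)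
    then obtain q where q: "\<And>k. q k \<in> \<rat>" "q \<longlonglongrightarrow> c" unfolding closure_sequential by blast
    have "(\<lambda>k. q k *\<^sub>R xs k + ys k) \<longlonglongrightarrow> c *\<^sub>R x + y"
      by (intro tendsto_intros xs ys q)
    moreover have "q k *\<^sub>R xs k + ys k \<in> D" for k using comb q xs ys by blast
    ultimately show ?thesis
      unfolding Y_def closure_sequential
      by (intro exI[of _ "\<lambda>k. q k *\<^sub>R xs k + ys k"]) simp
  qed
  have Y0: "0 \<in> Y" using D0D DY by auto
  show thesis
  proof
    show "subspace Y"
      using Y0 combY[of _ _ 1] combY[of _ 0] by (intro subspaceI) auto
    show "closed Y" by (simp add: Y_def)
    have "top_of_set Y closure_of D = Y"
      using DY by (simp add: closure_of_subtopology Int_absorb1) (simp add: Y_def)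
    then show "separable_space (top_of_set Y)"
      unfolding separable_space_def using countD DY by auto
    show "D0 \<subseteq> Y" using D0D DY by auto
    fix m and z :: "nat \<Rightarrow> 'a" and s :: real and U :: "'a set"
    assume zY: "\<forall>i\<le>n. z i \<in> Y"
      and PY: "\<forall>s>0. \<forall>U. finite U \<and> U \<subseteq> Y \<longrightarrow> P m z s U" and s: "0 < s" and U: "finite U"
    show "P m z s U"
    proof (rule ccontr)
      assume neg: "\<not> P m z s U"
      obtain j where j: "1 / real (Suc j) < s / 2"
        using nat_approx_posE[of "s / 2"] s by (metis half_gt_zero)
      define t where "t = 1 / real (Suc j)"
      have t: "0 < t" "t < s / 2" using j by (auto simp: t_def)
      \<comment> \<open>moving all n + 1 components by less than r costs at most slack t / 2\<close>
      define r where "r = t / (2 * (C + 1) * real (Suc n))"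
      have r: "0 < r" using t C by (simp add: r_def)
      have "\<exists>d\<in>D. dist d (z i) < r" if "i \<le> n" for i
        using zY that r unfolding Y_def closure_approachable by blast
      then obtain d where d: "\<And>i. i \<le> n \<Longrightarrow> d i \<in> D" "\<And>i. i \<le> n \<Longrightarrow> dist (d i) (z i) < r" 
        by metis
      define d' where "d' = restrict d {..n}"
      have d': "d' \<in> PiE {..n} (\<lambda>_. D)" using d by (auto simp: d'_def)
      have "(\<Sum>i\<le>n. norm (z i - d' i)) \<le> (\<Sum>i\<le>n. r)"
        using d by (intro sum_mono) (force simp: d'_def dist_norm norm_minus_commute)
      also have "\<dots> = real (Suc n) * r" by simp
      also have "\<dots> = t / (2 * (C + 1))" by (simp add: r_def del: of_nat_Suc)
      finally have "C * (\<Sum>i\<le>n. norm (z i - d' i)) \<le> C * (t / (2 * (C + 1)))"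
        using C by (rule mult_left_mono)
      also have "\<dots> \<le> t / 2" using C t by (simp add: field_simps)
      finally have close: "C * (\<Sum>i\<le>n. norm (z i - d' i)) \<le> t / 2"
        and close': "C * (\<Sum>i\<le>n. norm (d' i - z i)) \<le> t / 2"
        by (simp_all add: norm_minus_commute)
      \<comment> \<open>the condition fails at d' with slack t, so a defeating set was recorded for d'; it lies in Y
        and hence cannot defeat z with slack t / 2, which is the contradiction\<close>
      have "\<not> P m d' t U"
        using neg lip[of m d' t U z s] close' t by auto
      then have "bad m j d' U" using U by (simp add: bad_def t_def)
      then have "bad m j d' (W m j d')" by (rule W)
      then have "\<not> P m d' t (W m j d')" by (simp add: bad_def t_def)
      moreover have "P m z (t / 2) (W m j d')"
        using PY[rule_format, of "t / 2" "W m j d'"] t(1) WD[OF d', of m j] DY finW[of m j d'] by auto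
      ultimately show False
        using lip[of m z "t / 2" "W m j d'" d' t] close by auto
    qed
  qed
qed

section \<open>Sequential weak* compactness\<close>

definition swings :: "(nat \<Rightarrow> 'a \<Rightarrow> real) \<Rightarrow> real \<Rightarrow> nat set \<Rightarrow> 'a \<Rightarrow> real \<Rightarrow> bool" where
  "swings f e N v a \<longleftrightarrow> infinite {k \<in> N. f k v \<le> a} \<and> infinite {k \<in> N. a + e \<le> f k v}"

lemma infinite_along_subsequence:
  assumes "infinite {k. Q (r k)}" "strict_mono (r :: nat \<Rightarrow> nat)" "range r \<subseteq> N"
  shows "infinite {k \<in> N. Q k}"
proof
  assume "finite {k \<in> N. Q k}"
  moreover have "r ` {k. Q (r k)} \<subseteq> {k \<in> N. Q k}" using assms(3) by auto
  ultimately have "finite (r ` {k. Q (r k)})" by (rule finite_subset[rotated])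
  then show False
    using assms(1) strict_mono_imp_inj_on[OF assms(2)] by (metis finite_imageD inj_on_subset subset_UNIV)
qed

lemma swings_subsequence:
  assumes "swings (f \<circ> r) e UNIV v a" "strict_mono r" "range r \<subseteq> N"
  shows "swings f e N v a"
  using infinite_along_subsequence[OF _ assms(2,3), of "\<lambda>k. f k v \<le> a"]
    infinite_along_subsequence[OF _ assms(2,3), of "\<lambda>k. a + e \<le> f k v"] assms(1)
  by (simp add: swings_def)

text \<open>Otherwise every infinite \<open>M \<subseteq> N\<close> comes with a vector \<open>V M\<close> of norm at most 1 and a level \<open>A M\<close> such that the
  values at \<open>V M\<close> lie infinitely often below \<open>A M\<close> and infinitely often above \<open>A M + e\<close>. Splitting
  repeatedly gives a binary tree of infinite index sets. Along each branch \<open>\<beta>\<close>, weak* compactness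
  provides a functional \<open>g \<beta>\<close> that respects all splittings of the branch. Two branches disagree by at
  least \<open>e\<close> at the vector where they part, and only countably many vectors occur in the
  tree, so uncountably many functionals would be separated on a separable subspace.\<close>

lemma infinite_without_swings:
  fixes f :: "nat \<Rightarrow> 'a::banach \<Rightarrow> real"
  assumes asplund: "asplund_space TYPE('a)"
    and p: "\<And>x. p x \<le> L * norm x"
    and f: "\<And>k. f k \<in> dominated p" and e: "0 < e" and N: "infinite N"
  obtains N' where "N' \<subseteq> N" "infinite N'" "\<And>v a. norm v \<le> 1 \<Longrightarrow> \<not> swings f e N' v a"
proof (rule ccontr)
  assume neg: "\<not> thesis"
  note found = that
  have "\<exists>v a. norm v \<le> 1 \<and> swings f e M v a" if "M \<subseteq> N" "infinite M" for M
  proof (rule ccontr)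
    assume "\<not> ?thesis"
    then have "thesis" using that by (intro found[of M]) blast+
    then show False using neg by contradiction
  qed
  then obtain V A where VA: "\<And>M. M \<subseteq> N \<Longrightarrow> infinite M \<Longrightarrow> norm (V M) \<le> 1 \<and> swings f e M (V M) (A M)"
    by metis
  \<comment> \<open>the index set at a node; the list is the path to the node, most recent turn first\<close>
  define T where "T = rec_list N (\<lambda>b s M. if b then {k \<in> M. A M + e \<le> f k (V M)} 
      else {k \<in> M. f k (V M) \<le> A M})"
  have T_simps: "T [] = N"
    "T (b # s) = (if b then {k \<in> T s. A (T s) + e \<le> f k (V (T s))}
      else {k \<in> T s. f k (V (T s)) \<le> A (T s)})" for b s
    by (auto simp: T_def)
  have T: "T s \<subseteq> N \<and> infinite (T s)" for s
  proof (induction s)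
    case (Cons b s)
    then show ?case using VA[of "T s"] by (auto simp: T_simps swings_def)
  qed (use N in \<open>simp add: T_simps\<close>)
  \<comment> \<open>the first k turns of the branch that goes up exactly at the levels in \<open>\<beta>\<close>\<close>
  define s where "s \<beta> k = rev (map (\<lambda>i. i \<in> \<beta>) [0..<k])" for \<beta> :: "nat set" and k
  define M where "M \<beta> k = T (s \<beta> k)" for \<beta> k
  define G where "G \<beta> k = (if k \<in> \<beta> then {g. A (M \<beta> k) + e \<le> g (V (M \<beta> k))}
      else {g. g (V (M \<beta> k)) \<le> A (M \<beta> k)})" for \<beta> k
  have M_Suc: "j \<in> M \<beta> (Suc k) \<Longrightarrow> j \<in> M \<beta> k \<and> f j \<in> G \<beta> k" for j \<beta> k
    by (auto simp: M_def G_def s_def T_simps split: if_splits)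
  have M_less: "i < k \<Longrightarrow> j \<in> M \<beta> k \<Longrightarrow> f j \<in> G \<beta> i" for i j k \<beta>
    by (induction k) (use M_Suc in \<open>auto simp: less_Suc_eq\<close>)
  have branch: "dominated p \<inter> (\<Inter>k. G \<beta> k) \<noteq> {}" for \<beta>
  proof (rule compact_imp_fip_image[OF compact_dominated])
    show "closed (G \<beta> k)" for k
      unfolding G_def
      by (auto intro!: closed_Collect_le continuous_on_product_coordinates continuous_intros)
    fix I :: "nat set" assume "finite I"
    then obtain m where m: "I \<subseteq> {..<m}" using finite_nat_bounded by blast
    obtain j where "j \<in> M \<beta> m" using T unfolding M_def by (metis finite.emptyI ex_in_conv)
    then have "f j \<in> dominated p \<inter> (\<Inter>i\<in>I. G \<beta> i)" using f M_less m by blast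
    then show "dominated p \<inter> (\<Inter>i\<in>I. G \<beta> i) \<noteq> {}" by blast
  qed
  have "\<exists>g. g \<in> dominated p \<and> (\<forall>k. g \<in> G \<beta> k)" for \<beta> using branch[of \<beta>] by blast
  then obtain g where g: "\<And>\<beta>. g \<beta> \<in> dominated p" "\<And>\<beta> k. g \<beta> \<in> G \<beta> k" by metis
  have "countable (range (\<lambda>s. V (T s)))" by simp
  then obtain Y where Y: "subspace Y" "separable_space (top_of_set Y)" "range (\<lambda>s. V (T s)) \<subseteq> Y"
    by (rule separable_closing[where P = "\<lambda>_ _ _ _. True" and C = 0]) auto
  obtain B where B: "countable B" "B \<subseteq> dominated p"
    "\<And>f e. f \<in> dominated p \<Longrightarrow> 0 < e \<Longrightarrow> \<exists>g\<in>B. \<forall>y\<in>Y. \<bar>f y - g y\<bar> \<le> e * norm y"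
  proof (rule separable_dual_dense_subset[OF asplund Y(1,2), of "dominated p"])
    show "linear f" if "f \<in> dominated p" for f using that by (simp add: dominated_def)
    show "\<exists>L. \<forall>x. \<bar>f x\<bar> \<le> L * norm x" if "f \<in> dominated p" for f
      by (intro exI allI dominated_abs_le[OF that]) (rule p)
  qed (rule that)
  have "\<exists>h. h \<in> B \<and> (\<forall>y\<in>Y. \<bar>g \<beta> y - h y\<bar> \<le> e / 3 * norm y)" for \<beta>
    using B(3)[OF g(1), of "e / 3" \<beta>] e by auto
  then have "\<forall>\<beta>. \<exists>h. h \<in> B \<and> (\<forall>y\<in>Y. \<bar>g \<beta> y - h y\<bar> \<le> e / 3 * norm y)" ..
  from choice[OF this] obtain b where
    b: "\<And>\<beta>. b \<beta> \<in> B" "\<And>\<beta> y. y \<in> Y \<Longrightarrow> \<bar>g \<beta> y - b \<beta> y\<bar> \<le> e / 3 * norm y"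
    by blast
  have sep: False if "b \<beta> = b \<beta>'" "k \<in> \<beta>" "k \<notin> \<beta>'" "\<And>i. i < k \<Longrightarrow> i \<in> \<beta> \<longleftrightarrow> i \<in> \<beta>'" for \<beta> \<beta>' k
  proof -
    have "s \<beta> k = s \<beta>' k" using that(4) by (simp add: s_def)
    then have "M \<beta> k = M \<beta>' k" by (simp add: M_def)
    then have "A (M \<beta> k) + e \<le> g \<beta> (V (M \<beta> k))" "g \<beta>' (V (M \<beta> k)) \<le> A (M \<beta> k)"
      using g(2)[of \<beta> k] g(2)[of \<beta>' k] that(2,3) by (auto simp: G_def)
    moreover have v: "V (M \<beta> k) \<in> Y" using Y(3) by (auto simp: M_def)
    moreover have "e / 3 * norm (V (M \<beta> k)) \<le> e / 3 * 1"
      using VA T e by (intro mult_left_mono) (auto simp: M_def)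
    moreover have "\<bar>g \<beta>' (V (M \<beta> k)) - b \<beta> (V (M \<beta> k))\<bar> \<le> e / 3 * norm (V (M \<beta> k))"
      unfolding that(1) by (rule b(2)[OF v])
    ultimately show False using b(2)[OF v, of \<beta>] e unfolding abs_le_iff by linarith
  qed
  have "inj b"
  proof (rule injI, rule ccontr)
    fix \<beta> \<beta>' assume bb: "b \<beta> = b \<beta>'" and "\<beta> \<noteq> \<beta>'"
    then have "\<exists>k. (k \<in> \<beta>) \<noteq> (k \<in> \<beta>')" by blast
    then obtain k where "(k \<in> \<beta>) \<noteq> (k \<in> \<beta>')" "\<And>i. i < k \<Longrightarrow> i \<in> \<beta> \<longleftrightarrow> i \<in> \<beta>'"
      unfolding exists_least_iff[of "\<lambda>k. (k \<in> \<beta>) \<noteq> (k \<in> \<beta>')"] by blast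
    then show False using sep[of \<beta> \<beta>' k] sep[of \<beta>' \<beta> k] bb by auto
  qed
  moreover have "countable (range b)" using B(1) b(1) by (meson countable_subset image_subsetI)
  ultimately have "countable (UNIV :: nat set set)" using countable_image_inj_eq by blast
  then obtain h :: "nat \<Rightarrow> nat set" where h: "range h = UNIV"
    using range_from_nat_into[of "UNIV :: nat set set"] by (metis UNIV_not_empty)
  have "{i. i \<notin> h i} \<in> range h" unfolding h ..
  then obtain k where "{i. i \<notin> h i} = h k" ..
  then show False by blast
qed

lemma bounded_no_swings_imp_convergent:
  fixes X :: "nat \<Rightarrow> real"
  assumes "bounded (range X)"
    and no: "\<And>e a. 0 < e \<Longrightarrow> finite {k. X k \<le> a} \<or> finite {k. a + e \<le> X k}"
  shows "convergent X"
proof -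
  obtain l r where r: "strict_mono r" "(X \<circ> r) \<longlonglongrightarrow> l"
    using bounded_imp_convergent_subsequence[OF assms(1)] by blast
  have near: "infinite {k. Q (X k)}" if "eventually (\<lambda>k. Q (X (r k))) sequentially" for Q
  proof -
    obtain K where "\<And>k. k \<ge> K \<Longrightarrow> Q (X (r k))" using \<open>eventually _ _\<close> by (auto simp: eventually_sequentially)
    then have "{K..} \<subseteq> {k. Q (X (r k))}" by auto
    then have "infinite {k. Q (X (r k))}" using infinite_Ici infinite_super by blast
    then show ?thesis using infinite_along_subsequence[of "\<lambda>k. Q (X k)" r UNIV] r(1) by simp
  qed
  have "X \<longlonglongrightarrow> l"
  proof (rule order_tendstoI)
    fix c assume c: "c < l"
    have "infinite {k. (c + l) / 2 \<le> X k}"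
      using order_tendstoD(1)[OF r(2), of "(c + l) / 2"] c
      by (intro near) (auto elim: eventually_mono)
    then have "finite {k. X k \<le> c}" using no[of "(l - c) / 2" c] c by (simp add: field_simps)
    then show "eventually (\<lambda>k. c < X k) sequentially"
      by (simp add: cofinite_eq_sequentially[symmetric] eventually_cofinite not_less)
  next
    fix c assume c: "l < c"
    have "infinite {k. X k \<le> (c + l) / 2}"
      using order_tendstoD(2)[OF r(2), of "(c + l) / 2"] c
      by (intro near) (auto elim: eventually_mono)
    then have "finite {k. c \<le> X k}" using no[of "(c - l) / 2" "(c + l) / 2"] c by (simp add: field_simps)
    then show "eventually (\<lambda>k. X k < c) sequentially"
      by (simp add: cofinite_eq_sequentially[symmetric] eventually_cofinite not_less)
  qed
  then show ?thesis by (rule convergentI)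
qed

text \<open>A diagonal subsequence removes the swings of every size \<open>1 / (j + 1)\<close>, uniformly over the unit ball,
  which makes all value sequences converge.\<close>

lemma dominated_convergent_subsequence:
  fixes f :: "nat \<Rightarrow> 'a::banach \<Rightarrow> real"
  assumes asplund: "asplund_space TYPE('a)"
    and p: "\<And>x. p x \<le> L * norm x"
    and f: "\<And>k. f k \<in> dominated p"
  obtains r g where "strict_mono r" "g \<in> dominated p" "\<And>v. (\<lambda>k. f (r k) v) \<longlonglongrightarrow> g v"
proof -
  define P where "P j s \<longleftrightarrow> (\<forall>v a. norm v \<le> 1 \<longrightarrow> \<not> swings (f \<circ> s) (1 / real (Suc j)) UNIV v a)"
    for j and s :: "nat \<Rightarrow> nat"
  interpret subseqs P
  proof
    fix j and s :: "nat \<Rightarrow> nat" assume "strict_mono s"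
    obtain N where N: "N \<subseteq> UNIV" "infinite N"
      "\<And>v a. norm v \<le> 1 \<Longrightarrow> \<not> swings (f \<circ> s) (1 / real (Suc j)) N v a"
      by (rule infinite_without_swings[OF asplund p, where f = "f \<circ> s" and e = "1 / real (Suc j)" and N = UNIV]) (use f in auto)
    have "\<not> swings (f \<circ> s \<circ> enumerate N) (1 / real (Suc j)) UNIV v a" if "norm v \<le> 1" for v a
    proof
      assume "swings (f \<circ> s \<circ> enumerate N) (1 / real (Suc j)) UNIV v a"
      then have "swings (f \<circ> s) (1 / real (Suc j)) N v a"
        by (rule swings_subsequence) (simp_all add: N(2) strict_mono_enumerate range_enumerate)
      then show False using N(3)[OF that] by contradiction
    qed
    then show "\<exists>r'. strict_mono r' \<and> P j (s \<circ> r')"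
      unfolding P_def o_assoc
      by (intro exI[of _ "enumerate N"] conjI strict_mono_enumerate[OF N(2)] allI impI)
  qed
  have P_diag: "P j (diagseq \<circ> (+) (Suc j))" for j
  proof (rule diagseq_holds)
    fix r s :: "nat \<Rightarrow> nat" and n assume "strict_mono r" "P n s"
    then show "P n (s \<circ> r)"
      unfolding P_def o_assoc by (meson swings_subsequence subset_UNIV)
  qed
  have conv1: "convergent (\<lambda>k. f (diagseq k) v)" if v: "norm v \<le> 1" for v
  proof (rule bounded_no_swings_imp_convergent)
    have "\<bar>f (diagseq k) v\<bar> \<le> L * norm v" for k
      by (rule dominated_abs_le[OF f]) (rule p)
    then show "bounded (range (\<lambda>k. f (diagseq k) v))" by (intro boundedI[of _ "L * norm v"]) auto
    fix e a :: real assume e: "0 < e"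
    obtain j where j: "1 / real (Suc j) < e" using nat_approx_posE[OF e] .
    have shift: "finite {k. Q (diagseq k)}" if "finite {k. Q (diagseq (Suc j + k))}" for Q
    proof -
      have "{k. Q (diagseq k)} \<subseteq> {..j} \<union> (+) (Suc j) ` {k. Q (diagseq (Suc j + k))}"
      proof
        fix k assume "k \<in> {k. Q (diagseq k)}"
        then show "k \<in> {..j} \<union> (+) (Suc j) ` {k. Q (diagseq (Suc j + k))}"
          by (cases "k \<le> j") (auto intro!: image_eqI[of _ _ "k - Suc j"])
      qed
      then show ?thesis using that finite_subset by blast
    qed
    have "finite {k. f (diagseq (Suc j + k)) v \<le> a} \<or>
        finite {k. a + 1 / real (Suc j) \<le> f (diagseq (Suc j + k)) v}"
      using P_diag[of j] v by (auto simp: P_def swings_def)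
    then have "finite {k. f (diagseq k) v \<le> a} \<or> finite {k. a + 1 / real (Suc j) \<le> f (diagseq k) v}"
      using shift[of "\<lambda>k. f k v \<le> a"] shift[of "\<lambda>k. a + 1 / real (Suc j) \<le> f k v"] by blast
    moreover have "{k. a + e \<le> f (diagseq k) v} \<subseteq> {k. a + 1 / real (Suc j) \<le> f (diagseq k) v}"
      using j by auto
    ultimately show "finite {k. f (diagseq k) v \<le> a} \<or> finite {k. a + e \<le> f (diagseq k) v}"
      using finite_subset by blast
  qed
  have lin: "linear (f k)" and le: "f k x \<le> p x" for k x
    using f by (auto simp: dominated_def)
  have conv: "convergent (\<lambda>k. f (diagseq k) v)" for v
  proof -
    have "f k v = (norm v + 1) * f k ((1 / (norm v + 1)) *\<^sub>R v)" for k
      using linear_scale[OF lin, of k "1 / (norm v + 1)" v] by (simp add: field_simps add_nonneg_eq_0_iff)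
    moreover have "convergent (\<lambda>k. (norm v + 1) * f (diagseq k) ((1 / (norm v + 1)) *\<^sub>R v))"
      by (intro convergent_mult convergent_const conv1) (simp add: divide_le_eq not_less)
    ultimately show ?thesis by simp
  qed
  define g where "g v = lim (\<lambda>k. f (diagseq k) v)" for v
  have lim: "(\<lambda>k. f (diagseq k) v) \<longlonglongrightarrow> g v" for v
    using conv unfolding g_def by (simp add: convergent_LIMSEQ_iff)
  have "g \<in> dominated p"
    unfolding dominated_def
  proof (intro CollectI conjI allI linearI)
    fix x y and c :: real
    have "(\<lambda>k. f (diagseq k) (x + y)) \<longlonglongrightarrow> g x + g y"
      unfolding linear_add[OF lin] by (intro tendsto_add lim)
    then show "g (x + y) = g x + g y" using lim LIMSEQ_unique by blast
    have "(\<lambda>k. f (diagseq k) (c *\<^sub>R x)) \<longlonglongrightarrow> c *\<^sub>R g x"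
      unfolding linear_scale[OF lin] by (intro tendsto_intros lim)
    then show "g (c *\<^sub>R x) = c *\<^sub>R g x" using lim LIMSEQ_unique by blast
    show "g x \<le> p x" by (rule LIMSEQ_le_const2[OF lim]) (use le in auto)
  qed
  then show thesis using that subseq_diagseq lim by blast
qed

section \<open>Smoothing a sublinear functional along a separable subspace\<close>

text \<open>\<open>R w\<close> is the maximum of \<open>f w - \<kappa>' * \<theta> f\<close> over \<open>dominated p\<close> for a convex penalty \<open>\<theta>\<close>, and \<open>g w\<close>
  is a maximizer. Midpoint convexity turns near-maximality of another functional \<open>f\<close> into
  closeness of the distances \<open>a i f\<close> and \<open>a i (g w)\<close> from \<open>b i\<close> for each single \<open>i\<close>. Choosing \<open>b i\<close>
  close to \<open>g w\<close>, which is possible as \<open>w\<close> is fixed, makes \<open>f\<close> close to \<open>g w\<close> in the norm over \<open>Y\<close>. Only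
  the upper estimate of the increment is stated, since this is what minimality is tested with.\<close>

lemma smooth_approximation:
  fixes p :: "'a::banach \<Rightarrow> real" and Y :: "'a set"
  assumes asplund: "asplund_space TYPE('a)"
    and sub: "sublinear p" and p: "\<And>x. p x \<le> L * norm x" and L: "0 \<le> L"
    and Y: "subspace Y" "separable_space (top_of_set Y)" and \<kappa>: "0 < \<kappa>"
  obtains R :: "'a \<Rightarrow> real" and g :: "'a \<Rightarrow> 'a \<Rightarrow> real"
  where "\<And>w. R w \<le> p w" "\<And>w. p w - \<kappa> \<le> R w"
    "\<And>w w'. \<bar>R w - R w'\<bar> \<le> L * norm (w - w')"
    "\<And>w. g w \<in> dominated p" "\<And>w. p w - \<kappa> \<le> g w w"
    "\<And>w e. 0 < e \<Longrightarrow>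
      \<exists>\<delta>>0. \<forall>h\<in>Y. norm h \<le> \<delta> \<longrightarrow> R (w + h) \<le> R w + g w h + e * norm h"
proof -
  let ?K = "dominated p" and ?U = "{y \<in> Y. norm y \<le> 1}"
  have Kabs: "\<bar>f x\<bar> \<le> L * norm x" if "f \<in> ?K" for f x
    using that by (rule dominated_abs_le) (rule p)
  have Klin: "linear f" if "f \<in> ?K" for f using that by (simp add: dominated_def)
  obtain B where B: "countable B" "B \<subseteq> ?K"
    "\<And>f e. f \<in> ?K \<Longrightarrow> 0 < e \<Longrightarrow> \<exists>g\<in>B. \<forall>y\<in>Y. \<bar>f y - g y\<bar> \<le> e * norm y"
  proof (rule separable_dual_dense_subset[OF asplund Y, of ?K])
    show "\<exists>L. \<forall>x. \<bar>f x\<bar> \<le> L * norm x" if "f \<in> ?K" for f using Kabs[OF that] by blast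
  qed (rule Klin, assumption, rule that)
  have "B \<noteq> {}" using B(3)[of _ 1] dominated_nonempty[OF sub] by auto
  define b where "b = from_nat_into B"
  have bB: "b i \<in> B" for i unfolding b_def using \<open>B \<noteq> {}\<close> by (rule from_nat_into)
  then have bK: "b i \<in> ?K" for i using B(2) by blast
  have b_surj: "\<exists>i. b i = f" if "f \<in> B" for f
    using from_nat_into_surj[OF B(1) that] by (simp add: b_def)
  have U0: "0 \<in> ?U" using subspace_0[OF Y(1)] by simp

  \<comment> \<open>distance from \<open>b i\<close> in the dual of \<open>Y\<close>\<close>
  define a where "a i f = (SUP y\<in>?U. \<bar>f y - b i y\<bar>)" for i and f :: "'a \<Rightarrow> real"
  have val: "\<bar>f y - b i y\<bar> \<le> 2 * L" if "f \<in> ?K" "y \<in> ?U" for f y i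
  proof -
    have "L * norm y \<le> L * 1" using that(2) L by (intro mult_left_mono) auto
    then show ?thesis using Kabs[OF that(1), of y] Kabs[OF bK, of i y] by linarith
  qed
  have a_upper: "\<bar>f y - b i y\<bar> \<le> a i f" if "f \<in> ?K" "y \<in> ?U" for f y i
    unfolding a_def using that val[OF that(1)] by (intro cSUP_upper bdd_aboveI2[where M = "2 * L"]) auto
  have a_least: "a i f \<le> c" if "\<And>y. y \<in> ?U \<Longrightarrow> \<bar>f y - b i y\<bar> \<le> c" for f i c
    unfolding a_def using that U0 by (intro cSUP_least) auto
  have a_nn: "0 \<le> a i f" if "f \<in> ?K" for i f using a_upper[OF that U0, of i] by linarith
  have a_le: "a i f \<le> 2 * L" if "f \<in> ?K" for i f using val[OF that] by (intro a_least)
  have a_norm: "\<bar>f y - b i y\<bar> \<le> a i f * norm y" if "f \<in> ?K" "y \<in> Y" for f i y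
  proof (cases "y = 0")
    case False
    then have "(1 / norm y) *\<^sub>R y \<in> ?U" using subspace_scale[OF Y(1) that(2)] by simp
    from a_upper[OF that(1) this, of i] have "\<bar>(f y - b i y) / norm y\<bar> \<le> a i f"
      using linear_scale[OF Klin[OF that(1)]] linear_scale[OF Klin[OF bK]]
      by (simp add: diff_divide_distrib)
    then show ?thesis using False by (simp add: abs_divide divide_le_eq)
  qed (use linear_0[OF Klin[OF that(1)]] linear_0[OF Klin[OF bK]] in simp)

  define \<theta> where "\<theta> f = (\<Sum>i. (1 / 2) ^ i * (a i f)\<^sup>2)" for f
  \<comment> \<open>\<open>a i f \<le> 2 * L\<close> bounds the series by \<open>8 * L\<^sup>2\<close>; the summand 1 makes M positive\<close>
  define M where "M = 8 * L\<^sup>2 + 1"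
  have M: "0 < M" by (simp add: M_def add_nonneg_pos)
  have term_le: "(1 / 2) ^ i * (a i f)\<^sup>2 \<le> (1 / 2) ^ i * (2 * L)\<^sup>2" if "f \<in> ?K" for i f
    using a_nn[OF that] a_le[OF that] by (intro mult_left_mono power_mono) auto
  have geo: "(\<lambda>i. (1 / 2) ^ i * (2 * L)\<^sup>2) sums (2 * (2 * L)\<^sup>2)"
    using sums_mult2[OF geometric_sums[of "1 / 2 :: real"], of "(2 * L)\<^sup>2"] by simp
  have summ: "summable (\<lambda>i. (1 / 2) ^ i * (a i f)\<^sup>2)" if "f \<in> ?K" for f
    using geo term_le[OF that] by (intro summable_comparison_test'[OF sums_summable]) auto
  have \<theta>_nn: "0 \<le> \<theta> f" if "f \<in> ?K" for f
    unfolding \<theta>_def using summ[OF that] by (intro suminf_nonneg) auto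
  have \<theta>_le: "\<theta> f \<le> M" if "f \<in> ?K" for f
  proof -
    have "\<theta> f \<le> 2 * (2 * L)\<^sup>2"
      unfolding \<theta>_def sums_unique[OF geo]
      using term_le[OF that] summ[OF that] sums_summable[OF geo] by (intro suminf_le)
    then show ?thesis by (simp add: M_def power_mult_distrib)
  qed
  have mid: "(\<lambda>x. (f x + g x) / 2) \<in> ?K" if "f \<in> ?K" "g \<in> ?K" for f g
    unfolding dominated_def
  proof (intro CollectI conjI allI linearI)
    fix x
    have "f x \<le> p x" "g x \<le> p x" using that by (auto simp: dominated_def)
    then show "(f x + g x) / 2 \<le> p x" by simp
  qed (auto simp: linear_add[OF Klin[OF that(1)]] linear_add[OF Klin[OF that(2)]]
        linear_scale[OF Klin[OF that(1)]] linear_scale[OF Klin[OF that(2)]] algebra_simps add_divide_distrib)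
  have convex: "(1 / 2) ^ i * ((a i f - a i g)\<^sup>2 / 4) \<le> (\<theta> f + \<theta> g) / 2 - \<theta> (\<lambda>x. (f x + g x) / 2)"
    if f: "f \<in> ?K" and g: "g \<in> ?K" for i f g
  proof -
    let ?m = "\<lambda>x. (f x + g x) / 2"
    have m: "?m \<in> ?K" using mid[OF f g] .
    define c where "c j = ((1 / 2) ^ j * (a j f)\<^sup>2 + (1 / 2) ^ j * (a j g)\<^sup>2) / 2 - (1 / 2) ^ j * (a j ?m)\<^sup>2" for j
    have sc: "c sums ((\<theta> f + \<theta> g) / 2 - \<theta> ?m)"
      unfolding c_def \<theta>_def
      using summ[OF f] summ[OF g] summ[OF m] by (intro sums_diff sums_divide sums_add summable_sums)
    have low: "(1 / 2) ^ j * ((a j f - a j g)\<^sup>2 / 4) \<le> c j" for j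
    proof -
      have "a j ?m \<le> (a j f + a j g) / 2"
      proof (rule a_least)
        fix y assume "y \<in> ?U"
        then have "\<bar>f y - b j y\<bar> + \<bar>g y - b j y\<bar> \<le> a j f + a j g"
          using a_upper[OF f] a_upper[OF g] by (intro add_mono)
        then show "\<bar>?m y - b j y\<bar> \<le> (a j f + a j g) / 2" by (simp add: abs_le_iff field_simps) linarith
      qed
      then have "(a j ?m)\<^sup>2 \<le> ((a j f + a j g) / 2)\<^sup>2" using a_nn[OF m] by (intro power_mono)
      then have "(a j f - a j g)\<^sup>2 / 4 \<le> ((a j f)\<^sup>2 + (a j g)\<^sup>2) / 2 - (a j ?m)\<^sup>2"
        by (simp add: power2_eq_square field_simps)
      then have "(1 / 2) ^ j * ((a j f - a j g)\<^sup>2 / 4) \<le> (1 / 2) ^ j * (((a j f)\<^sup>2 + (a j g)\<^sup>2) / 2 - (a j ?m)\<^sup>2)"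
        by (intro mult_left_mono) auto
      then show ?thesis by (simp add: c_def algebra_simps add_divide_distrib)
    qed
    have cnn: "0 \<le> c j" for j using low[of j] by (rule order_trans[rotated]) simp
    have "c i \<le> suminf c"
      using sum_le_suminf[OF sums_summable[OF sc], of "{i}"] cnn by simp
    then show ?thesis using low[of i] sums_unique[OF sc] by simp
  qed

  define \<kappa>' where "\<kappa>' = \<kappa> / M"
  have \<kappa>': "0 < \<kappa>'" using \<kappa> M by (simp add: \<kappa>'_def)
  have pen: "\<kappa>' * \<theta> f \<le> \<kappa>" if "f \<in> ?K" for f
    using mult_left_mono[OF \<theta>_le[OF that], of \<kappa>'] \<kappa>' M by (simp add: \<kappa>'_def)
  define q where "q w f = f w - \<kappa>' * \<theta> f" for w f
  define R where "R w = (SUP f\<in>?K. q w f)" for w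
  have q_le: "q w f \<le> p w" if "f \<in> ?K" for w f
    using that mult_nonneg_nonneg[OF less_imp_le[OF \<kappa>'] \<theta>_nn[OF that]]
    by (auto simp: q_def dominated_def intro: order_trans[of _ "f w"])
  have R_upper: "q w f \<le> R w" if "f \<in> ?K" for w f
    unfolding R_def using that q_le by (intro cSUP_upper bdd_aboveI2[where M = "p w"]) auto
  have R_least: "R w \<le> c" if "\<And>f. f \<in> ?K \<Longrightarrow> q w f \<le> c" for w c
    unfolding R_def using that dominated_nonempty[OF sub] by (intro cSUP_least) auto
  have R_le: "R w \<le> p w" for w using q_le by (intro R_least)
  have R_ge: "p w - \<kappa> \<le> R w" for w
  proof -
    obtain f where "f \<in> ?K" "f w = p w" using dominated_attains[OF sub] .
    then show ?thesis using R_upper[of f w] pen[of f] by (simp add: q_def)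
  qed
  have R_lip: "R w - R w' \<le> L * norm (w - w')" for w w'
  proof -
    have "R w \<le> R w' + L * norm (w - w')"
    proof (rule R_least)
      fix f assume f: "f \<in> ?K"
      have "f w - f w' \<le> L * norm (w - w')"
        using Kabs[OF f, of "w - w'"] linear_diff[OF Klin[OF f]] by simp
      then show "q w f \<le> R w' + L * norm (w - w')" using R_upper[OF f, of w'] by (simp add: q_def)
    qed
    then show ?thesis by simp
  qed

  \<comment> \<open>The supremum is attained: a maximizing sequence has a weak* convergent subsequence, and \<open>\<theta>\<close>
    is weak* lower semicontinuous, being a supremum of finite sums that are continuous in f.\<close>
  have "\<exists>f. f \<in> ?K \<and> q w f = R w" for w
  proof -
    have "\<exists>f\<in>?K. R w - 1 / real (Suc k) < q w f" for k
    proof (rule ccontr)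
      assume "\<not> ?thesis"
      then have "R w \<le> R w - 1 / real (Suc k)" by (intro R_least) (auto simp: not_less)
      then show False by simp
    qed
    then obtain fs where fs: "\<And>k. fs k \<in> ?K" "\<And>k. R w - 1 / real (Suc k) < q w (fs k)" by metis
    obtain r f where r: "strict_mono r" and f: "f \<in> ?K" and lim: "\<And>v. (\<lambda>k. fs (r k) v) \<longlonglongrightarrow> f v"
      by (rule dominated_convergent_subsequence[OF asplund, where p = p and L = L and f = fs, OF p fs(1)])
        (rule that)
    have "(\<lambda>k. q w (fs k)) \<longlonglongrightarrow> R w"
    proof (rule tendsto_sandwich[where h = "\<lambda>_. R w"])
      show "(\<lambda>k. R w - 1 / real (Suc k)) \<longlonglongrightarrow> R w"
        using tendsto_diff[OF tendsto_const lim_1_over_n[THEN LIMSEQ_Suc], of "R w"] by simp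
    qed (intro always_eventually allI less_imp_le[OF fs(2)] R_upper[OF fs(1)] tendsto_const)+
    from LIMSEQ_subseq_LIMSEQ[OF this r] have "(\<lambda>k. q w (fs (r k))) \<longlonglongrightarrow> R w" by (simp add: o_def)
    then have "(\<lambda>k. (fs (r k) w - q w (fs (r k))) / \<kappa>') \<longlonglongrightarrow> (f w - R w) / \<kappa>'"
      using \<kappa>' by (intro tendsto_intros lim) auto
    then have \<theta>lim: "(\<lambda>k. \<theta> (fs (r k))) \<longlonglongrightarrow> (f w - R w) / \<kappa>'" using \<kappa>' by (simp add: q_def)
    have partial: "(\<Sum>i<N. (1 / 2) ^ i * (f (y i) - b i (y i))\<^sup>2) \<le> (f w - R w) / \<kappa>'"
      if y: "\<And>i. y i \<in> ?U" for N y
    proof (rule LIMSEQ_le[OF _ \<theta>lim])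
      show "(\<lambda>k. \<Sum>i<N. (1 / 2) ^ i * (fs (r k) (y i) - b i (y i))\<^sup>2) \<longlonglongrightarrow>
          (\<Sum>i<N. (1 / 2) ^ i * (f (y i) - b i (y i))\<^sup>2)"
        by (intro tendsto_intros lim)
      have "(\<Sum>i<N. (1 / 2) ^ i * (fs (r k) (y i) - b i (y i))\<^sup>2) \<le> \<theta> (fs (r k))" for k
      proof -
        have "(\<Sum>i<N. (1 / 2) ^ i * (fs (r k) (y i) - b i (y i))\<^sup>2) \<le>
            (\<Sum>i<N. (1 / 2) ^ i * (a i (fs (r k)))\<^sup>2)"
          using a_upper[OF fs(1) y] by (intro sum_mono mult_left_mono) (auto simp: abs_le_square_iff[symmetric] a_nn[OF fs(1)])
        also have "\<dots> \<le> \<theta> (fs (r k))"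
          unfolding \<theta>_def using summ[OF fs(1)] by (intro sum_le_suminf) auto
        finally show ?thesis .
      qed
      then show "\<exists>K. \<forall>k\<ge>K. (\<Sum>i<N. (1 / 2) ^ i * (fs (r k) (y i) - b i (y i))\<^sup>2) \<le> \<theta> (fs (r k))"
        by blast
    qed
    have "\<exists>y\<in>?U. a i f - 1 / real (Suc m) < \<bar>f y - b i y\<bar>" for i m
    proof (rule ccontr)
      assume "\<not> ?thesis"
      then have "a i f \<le> a i f - 1 / real (Suc m)" by (intro a_least) (auto simp: not_less)
      then show False by simp
    qed
    then obtain y where y: "\<And>i m. y i m \<in> ?U" "\<And>i m. a i f - 1 / real (Suc m) < \<bar>f (y i m) - b i (y i m)\<bar>"
      by metis
    have ylim: "(\<lambda>m. \<bar>f (y i m) - b i (y i m)\<bar>) \<longlonglongrightarrow> a i f" for i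
    proof (rule tendsto_sandwich[where h = "\<lambda>_. a i f"])
      show "(\<lambda>m. a i f - 1 / real (Suc m)) \<longlonglongrightarrow> a i f"
        using tendsto_diff[OF tendsto_const lim_1_over_n[THEN LIMSEQ_Suc], of "a i f"] by simp
    qed (intro always_eventually allI less_imp_le[OF y(2)] a_upper[OF f y(1)] tendsto_const)+
    have "(\<Sum>i<N. (1 / 2) ^ i * (a i f)\<^sup>2) \<le> (f w - R w) / \<kappa>'" for N
    proof (rule LIMSEQ_le_const2)
      show "(\<lambda>m. \<Sum>i<N. (1 / 2) ^ i * \<bar>f (y i m) - b i (y i m)\<bar>\<^sup>2) \<longlonglongrightarrow> (\<Sum>i<N. (1 / 2) ^ i * (a i f)\<^sup>2)"
        by (intro tendsto_intros ylim)
      show "\<exists>K. \<forall>m\<ge>K. (\<Sum>i<N. (1 / 2) ^ i * \<bar>f (y i m) - b i (y i m)\<bar>\<^sup>2) \<le> (f w - R w) / \<kappa>'"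
        using partial[OF y(1)] by simp
    qed
    then have "\<theta> f \<le> (f w - R w) / \<kappa>'" unfolding \<theta>_def by (intro suminf_le_const summ[OF f])
    then have "R w \<le> q w f" using \<kappa>' by (simp add: q_def field_simps)
    then show ?thesis using f R_upper[OF f, of w] by auto
  qed
  then have "\<forall>w. \<exists>f. f \<in> ?K \<and> q w f = R w" ..
  from choice[OF this] obtain g where gK: "\<And>w. g w \<in> ?K" and gR: "\<And>w. q w (g w) = R w" by blast

  show thesis
  proof
    show "R w \<le> p w" "p w - \<kappa> \<le> R w" "g w \<in> ?K" for w by (fact R_le R_ge gK)+
    show "\<bar>R w - R w'\<bar> \<le> L * norm (w - w')" for w w'
      using R_lip[of w w'] R_lip[of w' w] by (simp add: abs_le_iff norm_minus_commute)
    have "R w \<le> g w w" for w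
      using gR[of w] mult_nonneg_nonneg[OF less_imp_le[OF \<kappa>'] \<theta>_nn[OF gK[of w]]] by (simp add: q_def)
    then show "p w - \<kappa> \<le> g w w" for w using R_ge[of w] by (rule order_trans[rotated])
    fix w and e :: real assume e: "0 < e"
    obtain i where i: "\<And>y. y \<in> Y \<Longrightarrow> \<bar>g w y - b i y\<bar> \<le> e / 8 * norm y"
      using B(3)[OF gK, of "e / 8"] b_surj e by (metis divide_pos_pos zero_less_numeral)
    have ai: "a i (g w) \<le> e / 8"
    proof (rule a_least)
      fix y assume y: "y \<in> ?U"
      then have "e / 8 * norm y \<le> e / 8 * 1" using e by (intro mult_left_mono) auto
      then show "\<bar>g w y - b i y\<bar> \<le> e / 8" using i[of y] y by simp
    qed
    \<comment> \<open>near-maximality of \<open>g (w + h)\<close> at w holds up to \<open>2 * L * norm h\<close>; this \<open>\<delta>\<close> brings the two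
      distances from \<open>b i\<close> within e / 8 of each other\<close>
    define \<delta> where "\<delta> = \<kappa>' * ((1 / 2) ^ i * ((e / 8)\<^sup>2 / 4)) / (L + 1)"
    have "L + 1 \<noteq> 0" using L by simp
    have "(L + 1) * (x / (L + 1)) = x" for x using \<open>L + 1 \<noteq> 0\<close> by simp
    then have L\<delta>: "(L + 1) * \<delta> = \<kappa>' * ((1 / 2) ^ i * ((e / 8)\<^sup>2 / 4))"
      unfolding \<delta>_def .
    have \<delta>: "0 < \<delta>" using \<kappa>' e L by (simp add: \<delta>_def)
    have "R (w + h) \<le> R w + g w h + e * norm h" if h: "h \<in> Y" "norm h \<le> \<delta>" for h
    proof -
      let ?f = "g w" and ?g = "g (w + h)"
      let ?m = "\<lambda>x. (?f x + ?g x) / 2"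
      have m: "?m \<in> ?K" using mid gK by blast
      have gh: "?g (w + h) = ?g w + ?g h" and fh: "?f (w + h) = ?f w + ?f h"
        by (simp_all add: linear_add[OF Klin[OF gK]])
      have "R w + ?f h \<le> R (w + h)" using R_upper[OF gK[of w], of "w + h"] gR[of w] by (simp add: q_def fh)
      moreover have "q w ?g = R (w + h) - ?g h" using gR[of "w + h"] by (simp add: q_def gh)
      moreover have "\<bar>?f h\<bar> \<le> L * norm h" "\<bar>?g h\<bar> \<le> L * norm h" by (rule Kabs[OF gK])+
      ultimately have "q w ?f - 2 * (L * norm h) \<le> q w ?g" using gR[of w] by linarith
      moreover have "q w ?m \<le> q w ?f" unfolding gR by (rule R_upper[OF m])
      moreover have "u - (s + t) / 2 \<le> d" if "s - 2 * d \<le> t" "u \<le> s" for s t u d :: real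
        using that by (simp add: field_simps)
      ultimately have gap: "q w ?m - (q w ?f + q w ?g) / 2 \<le> L * norm h" by blast
      have "\<kappa>' * ((1 / 2) ^ i * ((a i ?f - a i ?g)\<^sup>2 / 4)) \<le> \<kappa>' * ((\<theta> ?f + \<theta> ?g) / 2 - \<theta> ?m)"
        using convex[OF gK gK] \<kappa>' by (intro mult_left_mono) auto
      also have "\<dots> = q w ?m - (q w ?f + q w ?g) / 2"
        by (simp add: q_def field_simps)
      also note gap
      also have "L * norm h \<le> (L + 1) * \<delta>" using h L by (intro mult_mono) auto
      also note L\<delta>
      finally have "\<kappa>' * ((1 / 2) ^ i * ((a i ?f - a i ?g)\<^sup>2 / 4)) \<le> \<kappa>' * ((1 / 2) ^ i * ((e / 8)\<^sup>2 / 4))" .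
      then have "(a i ?f - a i ?g)\<^sup>2 \<le> (e / 8)\<^sup>2" using \<kappa>' by simp
      then have "\<bar>a i ?f - a i ?g\<bar> \<le> e / 8" using e by (simp add: abs_le_square_iff[symmetric])
      then have ag: "a i ?g \<le> e / 4" using ai by linarith
      have "?g h - ?f h \<le> \<bar>?f h - b i h\<bar> + \<bar>?g h - b i h\<bar>" by linarith
      also have "\<dots> \<le> e / 8 * norm h + e / 4 * norm h"
        using a_norm[OF gK h(1), of "w + h" i] mult_right_mono[OF ag, of "norm h"] i[OF h(1)]
        by (intro add_mono) auto
      also have "\<dots> \<le> e * norm h" using e by (simp add: mult_right_mono flip: distrib_right)
      finally have "?g h - ?f h \<le> e * norm h" .
      moreover have "R (w + h) \<le> R w + ?g h" using gR[of "w + h"] R_upper[OF gK[of "w + h"], of w] by (simp add: q_def gh)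
      ultimately show ?thesis by linarith
    qed
    then show "\<exists>\<delta>>0. \<forall>h\<in>Y. norm h \<le> \<delta> \<longrightarrow> R (w + h) \<le> R w + g w h + e * norm h"
      using \<delta> by blast
  qed
qed

section \<open>Ekeland's variational principle\<close>

text \<open>The distance \<open>d\<close> is a parameter because it will be a sum over finitely many entries of sequences
  \<open>nat \<Rightarrow> 'a\<close>, which identifies sequences that differ elsewhere. From \<open>x\<close> one passes to an almost lowest point of the set \<open>S x\<close> of points
  that are better than \<open>x\<close> by at least \<open>e\<close> times the distance.\<close>

lemma ekeland:
  fixes d :: "'b \<Rightarrow> 'b \<Rightarrow> real" and \<Phi> :: "'b \<Rightarrow> real"
  assumes nn: "\<And>x y. 0 \<le> d x y" and refl: "\<And>x. d x x = 0"
    and tri: "\<And>x y z. d x z \<le> d x y + d y z"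
    and complete: "\<And>s. (\<And>k. s k \<in> M) \<Longrightarrow> (\<And>e. 0 < e \<Longrightarrow> \<exists>N. \<forall>m\<ge>N. \<forall>k\<ge>m. d (s m) (s k) < e) \<Longrightarrow>
      \<exists>l\<in>M. (\<lambda>k. d (s k) l) \<longlonglongrightarrow> 0 \<and> (\<lambda>k. \<Phi> (s k)) \<longlonglongrightarrow> \<Phi> l"
    and lower: "\<And>x. x \<in> M \<Longrightarrow> c \<le> \<Phi> x"
    and a: "a \<in> M" and e: "0 < e"
  obtains z where "z \<in> M" "\<Phi> z + e * d a z \<le> \<Phi> a" "\<And>x. x \<in> M \<Longrightarrow> \<Phi> z \<le> \<Phi> x + e * d z x"
proof -
  define S where "S x = {y \<in> M. \<Phi> y + e * d x y \<le> \<Phi> x}" for x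
  have S_refl: "x \<in> S x" if "x \<in> M" for x using that by (simp add: S_def refl)
  have S_trans: "u \<in> S x" if "y \<in> S x" "u \<in> S y" for x y u
  proof -
    have "e * d x u \<le> e * d x y + e * d y u"
      using mult_left_mono[OF tri[of x u y], of e] e by (simp add: distrib_left)
    then show ?thesis using that by (auto simp: S_def)
  qed
  have "\<exists>y\<in>S x. \<forall>u\<in>S x. \<Phi> y \<le> \<Phi> u + 1 / real (Suc k)" if "x \<in> M" for x k
  proof -
    have ne: "\<Phi> ` S x \<noteq> {}" using S_refl[OF that] by blast
    have bdd: "bdd_below (\<Phi> ` S x)" using lower by (intro bdd_belowI2[where m = c]) (auto simp: S_def)
    have "Inf (\<Phi> ` S x) < Inf (\<Phi> ` S x) + 1 / real (Suc k)" by simp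
    from cInf_lessD[OF ne this] obtain y where y: "y \<in> S x" "\<Phi> y < Inf (\<Phi> ` S x) + 1 / real (Suc k)"
      by blast
    have "\<Phi> y \<le> \<Phi> u + 1 / real (Suc k)" if "u \<in> S x" for u
      using cInf_lower[OF imageI[OF that] bdd] y(2) by linarith
    then show ?thesis using y(1) by blast
  qed
  then have "\<forall>x k. \<exists>y. x \<in> M \<longrightarrow> y \<in> S x \<and> (\<forall>u\<in>S x. \<Phi> y \<le> \<Phi> u + 1 / real (Suc k))" by blast
  then obtain step where nxt: "\<And>x k. x \<in> M \<Longrightarrow> step x k \<in> S x"
    "\<And>x k u. x \<in> M \<Longrightarrow> u \<in> S x \<Longrightarrow> \<Phi> (step x k) \<le> \<Phi> u + 1 / real (Suc k)" by metis
  define s where "s = rec_nat a (\<lambda>k x. step x k)"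
  have s0: "s 0 = a" and s_Suc: "s (Suc k) = step (s k) k" for k by (simp_all add: s_def)
  have SM: "S x \<subseteq> M" for x by (auto simp: S_def)
  have sM: "s k \<in> M" for k
  proof (induction k)
    case (Suc k)
    then show ?case unfolding s_Suc using nxt(1) SM by blast
  qed (simp add: s0 a)
  have later: "s k \<in> S (s m)" if "m \<le> k" for m k
    using that
  proof (induction k rule: dec_induct)
    case (step k)
    then show ?case unfolding s_Suc using S_trans nxt(1)[OF sM] by blast
  qed (rule S_refl[OF sM])
  then have drop: "\<Phi> (s k) + e * d (s m) (s k) \<le> \<Phi> (s m)" if "m \<le> k" for m k
    using that by (auto simp: S_def)
  have "decseq (\<lambda>k. \<Phi> (s k))"
  proof (rule decseq_SucI)
    show "\<Phi> (s (Suc k)) \<le> \<Phi> (s k)" for k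
      using drop[of k "Suc k"] mult_nonneg_nonneg[OF less_imp_le[OF e] nn[of "s k" "s (Suc k)"]] by simp
  qed
  then have "convergent (\<lambda>k. \<Phi> (s k))"
    using decseq_convergent[of "\<lambda>k. \<Phi> (s k)" c] lower[OF sM] convergentI by metis
  then have cauchy: "Cauchy (\<lambda>k. \<Phi> (s k))" by (rule convergent_Cauchy)
  obtain l where l: "l \<in> M" "(\<lambda>k. d (s k) l) \<longlonglongrightarrow> 0" "(\<lambda>k. \<Phi> (s k)) \<longlonglongrightarrow> \<Phi> l"
  proof -
    have "\<exists>N. \<forall>m\<ge>N. \<forall>k\<ge>m. d (s m) (s k) < r" if "0 < r" for r
    proof -
      obtain N where N: "\<And>m k. m \<ge> N \<Longrightarrow> k \<ge> N \<Longrightarrow> \<bar>\<Phi> (s m) - \<Phi> (s k)\<bar> < e * r"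
        using cauchy e \<open>0 < r\<close> unfolding Cauchy_def dist_real_def by (meson mult_pos_pos)
      have "d (s m) (s k) < r" if "N \<le> m" "m \<le> k" for m k
      proof -
        have "\<bar>\<Phi> (s m) - \<Phi> (s k)\<bar> < e * r" using N that by simp
        then have "e * d (s m) (s k) < e * r" using drop[OF that(2)] by linarith
        then show ?thesis using e by simp
      qed
      then show ?thesis by blast
    qed
    from complete[OF sM this] show thesis using that by blast
  qed
  have lS: "l \<in> S (s m)" for m
  proof -
    have "\<Phi> l + e * d (s m) l \<le> \<Phi> (s m)"
    proof (rule LIMSEQ_le_const2)
      show "(\<lambda>k. \<Phi> (s k) + e * (d (s m) l - d (s k) l)) \<longlonglongrightarrow> \<Phi> l + e * d (s m) l"
        using tendsto_add[OF l(3) tendsto_mult_left[OF tendsto_diff[OF tendsto_const l(2)], of e "d (s m) l"]]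
        by simp
      show "\<exists>N. \<forall>k\<ge>N. \<Phi> (s k) + e * (d (s m) l - d (s k) l) \<le> \<Phi> (s m)"
      proof (intro exI allI impI)
        fix k assume "m \<le> k"
        have "e * (d (s m) l - d (s k) l) \<le> e * d (s m) (s k)"
          using tri[of "s m" l "s k"] e by (intro mult_left_mono) auto
        then show "\<Phi> (s k) + e * (d (s m) l - d (s k) l) \<le> \<Phi> (s m)"
          using drop[OF \<open>m \<le> k\<close>] by linarith
      qed
    qed
    then show ?thesis using l(1) by (simp add: S_def)
  qed
  show thesis
  proof
    show "l \<in> M" by fact
    show "\<Phi> l + e * d a l \<le> \<Phi> a" using lS[of 0] by (simp add: S_def s0)
    fix x assume x: "x \<in> M"
    show "\<Phi> l \<le> \<Phi> x + e * d l x"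
    proof (rule ccontr)
      assume neg: "\<not> ?thesis"
      then have "x \<in> S l" using x by (simp add: S_def)
      then have "x \<in> S (s k)" for k using S_trans lS by blast
      then have le: "\<Phi> (s (Suc k)) \<le> \<Phi> x + 1 / real (Suc k)" for k
        unfolding s_Suc by (intro nxt(2) sM)
      have "\<Phi> l \<le> \<Phi> x"
      proof (rule LIMSEQ_le)
        show "(\<lambda>k. \<Phi> (s (Suc k))) \<longlonglongrightarrow> \<Phi> l" using l(3) by (rule LIMSEQ_Suc)
        show "(\<lambda>k. \<Phi> x + 1 / real (Suc k)) \<longlonglongrightarrow> \<Phi> x"
          using tendsto_add[OF tendsto_const lim_1_over_n[THEN LIMSEQ_Suc], of "\<Phi> x"] by simp
        show "\<exists>N. \<forall>k\<ge>N. \<Phi> (s (Suc k)) \<le> \<Phi> x + 1 / real (Suc k)" using le by blast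
      qed
      moreover have "0 \<le> e * d l x" using e nn by simp
      ultimately show False using neg by simp
    qed
  qed
qed

section \<open>Approximate multipliers\<close>

text \<open>Approximate optimality conditions at a tuple \<open>z\<close>, where \<open>z 0\<close> stands for \<open>x\<close> and \<open>z i\<close> for a point of
  \<open>\<Omega> i\<close>. The clauses say that \<open>f i\<close> is an approximate subgradient of \<open>p\<close> at \<open>z i - z 0\<close>, that \<open>- f i\<close> is an
  \<open>\<epsilon>\<close>-normal of \<open>\<Omega> i\<close> at \<open>z i\<close>, and that the sum of the \<open>f i\<close> has norm at most \<open>\<epsilon>\<close>; \<open>s\<close> is a slack and \<open>U\<close>
  the set of test vectors. The term with \<open>2 * L\<close> vanishes within distance \<open>\<delta>\<close> of \<open>z i\<close> and dominates
  \<open>- f i (u - z i)\<close> from distance \<open>2 * \<delta>\<close> on. It expresses the local condition by an inequality for all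
  \<open>u\<close> that is Lipschitz in \<open>z\<close>, uniformly in \<open>u\<close>, as the separable reduction requires.\<close>

definition multipliers where
  "multipliers p n \<Omega> L \<epsilon> \<delta> z s U f \<longleftrightarrow>
    (\<forall>i. f i \<in> dominated p) \<and>
    (\<forall>i\<in>{1..n::nat}. p (z i - z 0) - \<epsilon> - s \<le> f i (z i - z 0)) \<and>
    (\<forall>i\<in>{1..n}. \<forall>u\<in>U \<inter> \<Omega> i.
      - f i (u - z i) \<le> \<epsilon> * norm (u - z i) + 2 * L * max 0 (norm (u - z i) - \<delta>) + s) \<and>
    (\<forall>v\<in>U. (\<Sum>i=1..n. f i v) \<le> \<epsilon> * norm v + s)"

lemma multipliers_perturb:
  fixes p :: "'a::real_normed_vector \<Rightarrow> real" and z :: "nat \<Rightarrow> 'a"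
  assumes sub: "sublinear p" and p: "\<And>x. p x \<le> L * norm x" and L: "0 \<le> L" "0 \<le> \<epsilon>"
    and m: "multipliers p n \<Omega> L \<epsilon> \<delta> z s U f"
    and t: "s + (3 * L + \<epsilon>) * (\<Sum>i\<le>n. norm (z i - z' i)) \<le> t"
  shows "multipliers p n \<Omega> L \<epsilon> \<delta> z' t U f"
proof -
  define D where "D = (\<Sum>i\<le>n. norm (z i - z' i))"
  have D0: "0 \<le> D" by (simp add: D_def sum_nonneg)
  have fK: "\<And>i. f i \<in> dominated p" using m by (simp add: multipliers_def)
  then have lin: "\<And>i. linear (f i)" by (simp add: dominated_def)
  have fabs: "\<bar>f i x\<bar> \<le> L * norm x" for i x
    using fK by (rule dominated_abs_le) (rule p)
  have LD: "s + 3 * (L * D) + \<epsilon> * D \<le> t" using t by (simp add: D_def algebra_simps)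
  have nz: "norm (z i - z' i) \<le> D" if "i \<le> n" for i
    unfolding D_def using that by (intro member_le_sum) auto
  have LDe: "0 \<le> \<epsilon> * D" "0 \<le> L * D" using L D0 by auto
  show ?thesis
    unfolding multipliers_def
  proof (intro conjI ballI allI)
    show "f i \<in> dominated p" for i by (rule fK)
    fix i assume i: "i \<in> {1..n}"
    have iD: "norm (z i - z' i) + norm (z 0 - z' 0) \<le> D"
    proof -
      have "norm (z i - z' i) + norm (z 0 - z' 0) = (\<Sum>j\<in>{i, 0}. norm (z j - z' j))" using i by simp
      also have "\<dots> \<le> D" unfolding D_def using i by (intro sum_mono2) auto
      finally show ?thesis .
    qed
    define h where "h = (z' i - z' 0) - (z i - z 0)"
    have "norm h \<le> norm (z i - z' i) + norm (z 0 - z' 0)"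
      using norm_triangle_ineq4[of "z 0 - z' 0" "z i - z' i"] by (simp add: h_def algebra_simps)
    then have h: "L * norm h \<le> L * D" using iD L by (intro mult_left_mono) auto
    have "f i (z' i - z' 0) = f i (z i - z 0) + f i h"
      using linear_add[OF lin, of i "z i - z 0" h] by (simp add: h_def)
    moreover have "p (z' i - z' 0) \<le> p (z i - z 0) + p h"
      using sublinear_add[OF sub, of "z i - z 0" h] by (simp add: h_def)
    moreover have "p (z i - z 0) - \<epsilon> - s \<le> f i (z i - z 0)" using m i by (simp add: multipliers_def)
    ultimately show "p (z' i - z' 0) - \<epsilon> - t \<le> f i (z' i - z' 0)"
      using fabs[of i h] p[of h] h LD LDe by linarith
    fix u assume u: "u \<in> U \<inter> \<Omega> i"
    let ?r = "norm (u - z i)" and ?r' = "norm (u - z' i)"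
    have zi: "norm (z i - z' i) \<le> D" using nz i by simp
    have r: "?r \<le> ?r' + D"
      using norm_triangle_ineq4[of "u - z' i" "z i - z' i"] zi by simp
    have "- f i (u - z i) \<le> \<epsilon> * ?r + 2 * L * max 0 (?r - \<delta>) + s" using m i u unfolding multipliers_def by blast
    moreover have "\<epsilon> * ?r \<le> \<epsilon> * (?r' + D)" using r L by (intro mult_left_mono) auto
    moreover have "2 * L * max 0 (?r - \<delta>) \<le> 2 * L * (max 0 (?r' - \<delta>) + D)"
      using r D0 L by (intro mult_left_mono) auto
    moreover have "f i (u - z' i) = f i (u - z i) + f i (z i - z' i)"
      using linear_add[OF lin, of i "u - z i" "z i - z' i"] by simp
    moreover have "L * norm (z i - z' i) \<le> L * D" using zi L by (intro mult_left_mono) auto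
    ultimately show "- f i (u - z' i) \<le> \<epsilon> * ?r' + 2 * L * max 0 (?r' - \<delta>) + t"
      using fabs[of i "z i - z' i"] LD by (simp only: distrib_left)
  next
    fix v assume "v \<in> U"
    then have "(\<Sum>i=1..n. f i v) \<le> \<epsilon> * norm v + s" using m by (simp add: multipliers_def)
    then show "(\<Sum>i=1..n. f i v) \<le> \<epsilon> * norm v + t" using LD LDe by linarith
  qed
qed

text \<open>Each condition involves one test vector and one slack and is weak* closed in \<open>f\<close>, so the finite
  intersection property applies.\<close>

lemma multipliers_compactness:
  fixes p :: "'a::real_normed_vector \<Rightarrow> real" and z :: "nat \<Rightarrow> 'a"
  assumes ex: "\<And>s U. 0 < s \<Longrightarrow> finite U \<Longrightarrow> \<exists>f. multipliers p n \<Omega> L \<epsilon> \<delta> z s U f"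
  obtains f where "multipliers p n \<Omega> L \<epsilon> \<delta> z 0 UNIV f"
proof -
  define K where "K = PiE UNIV (\<lambda>_ :: nat. dominated p)"
  have K: "compact K" unfolding K_def by (intro compact_PiE_UNIV compact_dominated)
  have ev: "continuous_on UNIV (\<lambda>f :: nat \<Rightarrow> 'a \<Rightarrow> real. f i x)" for i x
    by (rule continuous_on_product_then_coordinatewise[OF continuous_on_product_coordinates])
  \<comment> \<open>the condition for the single test vector u with slack 1 / (j + 1)\<close>
  define C where "C = (\<lambda>(j, u). 
     (\<Inter>i\<in>{1..n}. {f. p (z i - z 0) - \<epsilon> \<le> f i (z i - z 0) + 1 / real (Suc j)}) \<inter>
     (\<Inter>i\<in>{i\<in>{1..n}. u \<in> \<Omega> i}. {f.
      - f i (u - z i) \<le> \<epsilon> * norm (u - z i) + 2 * L * max 0 (norm (u - z i) - \<delta>) + 1 / real (Suc j)}) \<inter>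
     {f. (\<Sum>i=1..n. f i u) \<le> \<epsilon> * norm u + 1 / real (Suc j)})"
  have C_iff: "f \<in> C (j, u) \<longleftrightarrow>
      (\<forall>i\<in>{1..n}. p (z i - z 0) - \<epsilon> \<le> f i (z i - z 0) + 1 / real (Suc j)) \<and>
      (\<forall>i\<in>{1..n}. u \<in> \<Omega> i \<longrightarrow>
        - f i (u - z i) \<le> \<epsilon> * norm (u - z i) + 2 * L * max 0 (norm (u - z i) - \<delta>) + 1 / real (Suc j)) \<and>
      (\<Sum>i=1..n. f i u) \<le> \<epsilon> * norm u + 1 / real (Suc j)" for f j u
    by (simp only: C_def prod.case Int_iff INT_iff mem_Collect_eq Ball_def imp_conjL conj_assoc)
  have "K \<inter> (\<Inter>ju. C ju) \<noteq> {}"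
  proof (rule compact_imp_fip_image[OF K])
    fix ju :: "nat \<times> 'a"
    show "closed (C ju)"
      unfolding C_def
      by (cases ju) (auto intro!: closed_Int closed_INT closed_Collect_le continuous_intros ev)
  next
    fix I :: "(nat \<times> 'a) set" assume I: "finite I"
    define J where "J = Max (insert 0 (fst ` I))"
    obtain f where f: "multipliers p n \<Omega> L \<epsilon> \<delta> z (1 / real (Suc J)) (snd ` I) f"
      using ex[of "1 / real (Suc J)" "snd ` I"] I by auto
    have "f \<in> C (j, u)" if "(j, u) \<in> I" for j u
    proof -
      have "j \<le> J" unfolding J_def using I that by (intro Max_ge) force+
      then have "1 / real (Suc J) \<le> 1 / real (Suc j)" by (simp add: frac_le)
      then have weaker: "x \<le> y + 1 / real (Suc j)" if "x \<le> y + 1 / real (Suc J)" for x y :: real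
        using that by linarith
      have u: "u \<in> snd ` I" using that by force
      show ?thesis
        unfolding C_iff
      proof (intro conjI ballI impI)
        fix i assume i: "i \<in> {1..n}"
        have "p (z i - z 0) - \<epsilon> - 1 / real (Suc J) \<le> f i (z i - z 0)"
          using f i unfolding multipliers_def by blast
        then show "p (z i - z 0) - \<epsilon> \<le> f i (z i - z 0) + 1 / real (Suc j)"
          by (intro weaker) linarith
        assume "u \<in> \<Omega> i"
        then show "- f i (u - z i) \<le> \<epsilon> * norm (u - z i) + 2 * L * max 0 (norm (u - z i) - \<delta>) + 1 / real (Suc j)"
          using f i u unfolding multipliers_def by (intro weaker) blast
      next
        show "(\<Sum>i=1..n. f i u) \<le> \<epsilon> * norm u + 1 / real (Suc j)"
          using f u unfolding multipliers_def by (intro weaker) blast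
      qed
    qed
    moreover have "f \<in> K" using f by (auto simp: K_def multipliers_def)
    ultimately show "K \<inter> (\<Inter>ju\<in>I. C ju) \<noteq> {}" by auto
  qed
  then obtain f where fK: "f \<in> K" and "\<And>j u. f \<in> C (j, u)" by blast
  note f = this(2)[unfolded C_iff]
  have lim: "x \<le> y" if "\<And>j. x \<le> y + 1 / real (Suc j)" for x y :: real
  proof (rule field_le_epsilon)
    fix e :: real assume "0 < e"
    then obtain j where "1 / real (Suc j) < e" by (rule nat_approx_posE)
    then show "x \<le> y + e" using that[of j] by linarith
  qed
  have "multipliers p n \<Omega> L \<epsilon> \<delta> z 0 UNIV f"
    unfolding multipliers_def
  proof (intro conjI ballI allI)
    show "f i \<in> dominated p" for i using fK by (auto simp: K_def)
    fix i assume i: "i \<in> {1..n}"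
    have "p (z i - z 0) - \<epsilon> \<le> f i (z i - z 0)"
    proof (rule lim)
      show "p (z i - z 0) - \<epsilon> \<le> f i (z i - z 0) + 1 / real (Suc j)" for j
        using f[of j 0] i by blast
    qed
    then show "p (z i - z 0) - \<epsilon> - 0 \<le> f i (z i - z 0)" by simp
    fix u assume u: "u \<in> UNIV \<inter> \<Omega> i"
    show "- f i (u - z i) \<le> \<epsilon> * norm (u - z i) + 2 * L * max 0 (norm (u - z i) - \<delta>) + 0"
      unfolding add_0_right
    proof (rule lim, goal_cases)
      case (1 j)
      then show ?case using f[of j u] i u by blast
    qed
  next
    fix v :: 'a
    show "(\<Sum>i=1..n. f i v) \<le> \<epsilon> * norm v + 0"
      unfolding add_0_right
    proof (rule lim, goal_cases)
      case (1 j)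
      then show ?case using f[of j v] by blast
    qed
  qed
  then show thesis by (rule that)
qed

text \<open>Ekeland's principle is applied to the smoothed problem, restricted to tuples in a separable
  subspace \<open>Y\<close> that is closed under test vectors. The derivatives of the smoothing at the resulting
  point are multipliers as far as \<open>Y\<close> can tell. The separable reduction and compactness then provide
  other multipliers, at the same point, for the whole space.\<close>

lemma approximate_multipliers:
  fixes p :: "'a::banach \<Rightarrow> real" and \<Omega> :: "nat \<Rightarrow> 'a set" and zbar :: "nat \<Rightarrow> 'a"
  assumes asplund: "asplund_space TYPE('a)"
    and sub: "sublinear p" and p: "\<And>x. p x \<le> L * norm x" and L: "0 \<le> L"
    and cl: "\<And>i. i \<in> {1..n} \<Longrightarrow> closed (\<Omega> i)" and zbar: "\<And>i. i \<in> {1..n} \<Longrightarrow> zbar i \<in> \<Omega> i"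
    and r: "0 < r"
    and opt: "\<And>z. norm (z 0 - zbar 0) \<le> r \<Longrightarrow> (\<And>i. i \<in> {1..n} \<Longrightarrow> z i \<in> \<Omega> i) \<Longrightarrow>
      (\<Sum>i=1..n. p (zbar i - zbar 0)) \<le> (\<Sum>i=1..n. p (z i - z 0))"
    and \<epsilon>: "0 < \<epsilon>"
  obtains z f \<delta> where "\<And>i. i \<le> n \<Longrightarrow> norm (z i - zbar i) \<le> \<epsilon>" "\<And>i. i \<in> {1..n} \<Longrightarrow> z i \<in> \<Omega> i"
    "0 < \<delta>" "multipliers p n \<Omega> L \<epsilon> \<delta> z 0 UNIV f"
proof -
  \<comment> \<open>\<open>\<eta>\<close> bounds the distance from zbar, e is the constant in Ekeland's principle and e' the
    differentiability error. The smoothing error \<open>\<kappa>\<close> makes zbar optimal up to \<open>n * \<kappa> \<le> e * \<eta>\<close>.\<close>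
  define \<eta> where "\<eta> = min \<epsilon> (r / 2)"
  define e where "e = \<epsilon> / 3"
  define e' where "e' = \<epsilon> / (3 * real (Suc n))"
  define \<kappa> where "\<kappa> = min \<epsilon> (e * \<eta> / real (Suc n))"
  have e: "0 < e" "0 < e'" "0 < \<kappa>" "0 < \<eta>" using \<epsilon> r by (auto simp: e_def e'_def \<kappa>_def \<eta>_def)
  have e'_sum: "real n * e' \<le> \<epsilon> / 3" using \<epsilon> by (simp add: e'_def field_simps)
  have e'_le: "e' \<le> \<epsilon> / 3" using \<epsilon> by (simp add: e'_def field_simps)
  have \<kappa>_sum: "real n * \<kappa> \<le> e * \<eta>"
  proof -
    have "real n * \<kappa> \<le> real (Suc n) * (e * \<eta> / real (Suc n))"
      using e by (intro mult_mono) (auto simp: \<kappa>_def)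
    then show ?thesis by (simp del: of_nat_Suc)
  qed

  have "countable (zbar ` {..n})" by simp
  then obtain Y where Y: "subspace Y" "closed Y" "separable_space (top_of_set Y)" "zbar ` {..n} \<subseteq> Y"
    and lift: "\<And>m z s U. \<forall>i\<le>n. z i \<in> Y \<Longrightarrow>
        \<forall>s>0. \<forall>U. finite U \<and> U \<subseteq> Y \<longrightarrow> (\<exists>f. multipliers p n \<Omega> L \<epsilon> (1 / real (Suc m)) z s U f) \<Longrightarrow>
        0 < s \<Longrightarrow> finite U \<Longrightarrow> \<exists>f. multipliers p n \<Omega> L \<epsilon> (1 / real (Suc m)) z s U f"
  proof (rule separable_closing[where n = n and C = "3 * L + \<epsilon>" and
      P = "\<lambda>m z s U. \<exists>f. multipliers p n \<Omega> L \<epsilon> (1 / real (Suc m)) z s U f"])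
    show "0 \<le> 3 * L + \<epsilon>" using L \<epsilon> by simp
    show "\<exists>f. multipliers p n \<Omega> L \<epsilon> (1 / real (Suc m)) z' t U f"
      if "\<exists>f. multipliers p n \<Omega> L \<epsilon> (1 / real (Suc m)) z s U f"
        "s + (3 * L + \<epsilon>) * (\<Sum>i\<le>n. norm (z i - z' i)) \<le> t" for m z z' s t U
    proof -
      from that(1) obtain f where f: "multipliers p n \<Omega> L \<epsilon> (1 / real (Suc m)) z s U f" ..
      have "multipliers p n \<Omega> L \<epsilon> (1 / real (Suc m)) z' t U f"
        by (rule multipliers_perturb[OF sub _ L less_imp_le[OF \<epsilon>] f that(2)]) (rule p)
      then show ?thesis by blast
    qed
  qed (rule that)

  obtain R g where R: "\<And>w. R w \<le> p w" "\<And>w. p w - \<kappa> \<le> R w"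
    "\<And>w w'. \<bar>R w - R w'\<bar> \<le> L * norm (w - w')"
    and g: "\<And>w. g w \<in> dominated p" "\<And>w. p w - \<kappa> \<le> g w w"
    "\<And>w e. 0 < e \<Longrightarrow> \<exists>\<delta>>0. \<forall>h\<in>Y. norm h \<le> \<delta> \<longrightarrow> R (w + h) \<le> R w + g w h + e * norm h"
    by (rule smooth_approximation[OF asplund sub p L Y(1,3) e(3)]) (rule that)
  have R_tendsto: "(\<lambda>k. R (x k)) \<longlonglongrightarrow> R l" if "x \<longlonglongrightarrow> l" for x :: "nat \<Rightarrow> 'a" and l
  proof (rule LIM_zero_cancel, rule Lim_null_comparison)
    show "eventually (\<lambda>k. norm (R (x k) - R l) \<le> L * norm (x k - l)) sequentially" using R(3) by simp
    show "(\<lambda>k. L * norm (x k - l)) \<longlonglongrightarrow> 0"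
      using tendsto_mult_left[OF tendsto_norm_zero[OF LIM_zero[OF that]], of L] by simp
  qed

  define M where "M = {z. z 0 \<in> Y \<inter> cball (zbar 0) r \<and> (\<forall>i\<in>{1..n}. z i \<in> Y \<inter> \<Omega> i)}"
  define d where "d z z' = (\<Sum>i\<le>n. norm (z i - z' i))" for z z' :: "nat \<Rightarrow> 'a"
  define \<Phi> where "\<Phi> z = (\<Sum>i=1..n. R (z i - z 0))" for z :: "nat \<Rightarrow> 'a"
  have d_i: "norm (z i - z' i) \<le> d z z'" if "i \<le> n" for z z' i
    unfolding d_def using that by (intro member_le_sum) auto
  have d_upd: "d z (z(i := u)) = norm (z i - u)" if "i \<le> n" for z i u
  proof -
    have "d z (z(i := u)) = (\<Sum>j\<in>{i}. norm (z j - (z(i := u)) j))"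
      unfolding d_def using that by (intro sum.mono_neutral_right) auto
    then show ?thesis by simp
  qed
  have near_opt: "\<Phi> zbar \<le> \<Phi> z + real n * \<kappa>" if "z \<in> M" for z
  proof -
    have "\<Phi> zbar \<le> (\<Sum>i=1..n. p (zbar i - zbar 0))" unfolding \<Phi>_def using R(1) by (intro sum_mono)
    also have "\<dots> \<le> (\<Sum>i=1..n. p (z i - z 0))"
      using that by (intro opt) (auto simp: M_def dist_norm norm_minus_commute)
    also have "\<dots> \<le> (\<Sum>i=1..n. R (z i - z 0) + \<kappa>)"
      using R(2) by (intro sum_mono) (simp add: diff_le_eq)
    finally show ?thesis by (simp add: \<Phi>_def sum.distrib)
  qed
  obtain z where z: "z \<in> M" "\<Phi> z + e * d zbar z \<le> \<Phi> zbar"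
    and min: "\<And>x. x \<in> M \<Longrightarrow> \<Phi> z \<le> \<Phi> x + e * d z x"
  proof (rule ekeland[where d = d and \<Phi> = \<Phi> and M = M and a = zbar and e = e])
    show "0 \<le> d x y" for x y by (simp add: d_def sum_nonneg)
    show "d x x = 0" for x by (simp add: d_def)
    show "d x u \<le> d x y + d y u" for x y u
      unfolding d_def sum.distrib[symmetric]
      by (intro sum_mono) (metis norm_triangle_ineq diff_add_cancel add_diff_eq)
    show "zbar \<in> M" using zbar Y(4) r by (auto simp: M_def)
    show "\<Phi> zbar - real n * \<kappa> \<le> \<Phi> x" if "x \<in> M" for x using near_opt[OF that] by simp
    fix s :: "nat \<Rightarrow> nat \<Rightarrow> 'a" assume sM: "\<And>k. s k \<in> M" and cauchy: "\<And>e. 0 < e \<Longrightarrow> \<exists>N. \<forall>m\<ge>N. \<forall>k\<ge>m. d (s m) (s k) < e"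
    have "\<exists>l. (\<lambda>k. s k i) \<longlonglongrightarrow> l" if "i \<le> n" for i
    proof -
      have "Cauchy (\<lambda>k. s k i)"
      proof (rule metric_CauchyI)
        fix e :: real assume "0 < e"
        then obtain N where N: "\<And>m k. N \<le> m \<Longrightarrow> m \<le> k \<Longrightarrow> d (s m) (s k) < e" using cauchy by blast
        have "dist (s m i) (s k i) < e" if "N \<le> m" "N \<le> k" for m k
        proof (cases "m \<le> k")
          case True
          then show ?thesis using N[of m k] d_i[OF \<open>i \<le> n\<close>, of "s m" "s k"] that by (simp add: dist_norm)
        next
          case False
          then show ?thesis using N[of k m] d_i[OF \<open>i \<le> n\<close>, of "s k" "s m"] that
            by (simp add: dist_norm norm_minus_commute)
        qed
        then show "\<exists>N. \<forall>m\<ge>N. \<forall>k\<ge>N. dist (s m i) (s k i) < e" by blast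
      qed
      then show ?thesis using Cauchy_convergent_iff convergent_def by blast
    qed
    then obtain l where l: "\<And>i. i \<le> n \<Longrightarrow> (\<lambda>k. s k i) \<longlonglongrightarrow> l i" by metis
    have "l \<in> M"
    proof -
      have "l 0 \<in> Y \<inter> cball (zbar 0) r"
        by (rule closed_sequentially[OF _ _ l]) (use Y(2) sM in \<open>auto simp: M_def\<close>)
      moreover have "l i \<in> Y \<inter> \<Omega> i" if "i \<in> {1..n}" for i
        by (rule closed_sequentially[OF _ _ l]) (use Y(2) cl[OF that] sM that in \<open>auto simp: M_def\<close>)
      ultimately show ?thesis by (simp add: M_def)
    qed
    moreover have "(\<lambda>k. d (s k) l) \<longlonglongrightarrow> 0"
      unfolding d_def
      by (intro tendsto_null_sum tendsto_norm_zero LIM_zero l) simp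
    moreover have "(\<lambda>k. \<Phi> (s k)) \<longlonglongrightarrow> \<Phi> l"
      unfolding \<Phi>_def by (intro tendsto_sum R_tendsto tendsto_diff l) auto
    ultimately show "\<exists>l\<in>M. (\<lambda>k. d (s k) l) \<longlonglongrightarrow> 0 \<and> (\<lambda>k. \<Phi> (s k)) \<longlonglongrightarrow> \<Phi> l" by blast
  qed (rule e(1), rule that)
  have "e * d zbar z \<le> e * \<eta>" using z(2) near_opt[OF z(1)] \<kappa>_sum by linarith
  then have d\<eta>: "d zbar z \<le> \<eta>" using e by simp
  have close: "norm (z i - zbar i) \<le> \<eta>" if "i \<le> n" for i
    using d_i[OF that, of zbar z] d\<eta> by (simp add: norm_minus_commute)
  have z0: "z 0 \<in> Y" and zi: "\<And>i. i \<in> {1..n} \<Longrightarrow> z i \<in> Y \<inter> \<Omega> i" using z(1) by (auto simp: M_def)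
  have zY: "z i \<in> Y" if "i \<le> n" for i using z0 zi[of i] that by (cases "i = 0") auto
  define f where "f i = g (z i - z 0)" for i
  have fK: "f i \<in> dominated p" for i by (simp add: f_def g(1))
  have lin: "linear (f i)" for i using fK by (simp add: dominated_def)
  have fabs: "\<bar>f i x\<bar> \<le> L * norm x" for i x using fK by (rule dominated_abs_le) (rule p)

  have "\<exists>\<delta>>0. \<forall>i\<in>{1..n}. \<forall>h\<in>Y. norm h \<le> \<delta> \<longrightarrow>
      R (z i - z 0 + h) \<le> R (z i - z 0) + f i h + e' * norm h"
  proof -
    have "\<forall>i. \<exists>\<delta>>0. \<forall>h\<in>Y. norm h \<le> \<delta> \<longrightarrow> R (z i - z 0 + h) \<le> R (z i - z 0) + f i h + e' * norm h"
      using g(3)[OF e(2)] by (simp add: f_def)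
    from choice[OF this] obtain \<delta> where \<delta>: "\<And>i. 0 < \<delta> i"
      "\<And>i h. h \<in> Y \<Longrightarrow> norm h \<le> \<delta> i \<Longrightarrow> R (z i - z 0 + h) \<le> R (z i - z 0) + f i h + e' * norm h" by blast
    have "0 < Min (insert 1 (\<delta> ` {1..n}))" using \<delta>(1) by auto
    moreover have "Min (insert 1 (\<delta> ` {1..n})) \<le> \<delta> i" if "i \<in> {1..n}" for i using that by (intro Min_le) auto
    ultimately show ?thesis using \<delta>(2) by (meson order_trans)
  qed
  then obtain \<delta> where \<delta>: "0 < \<delta>" and smooth: "\<And>i h. i \<in> {1..n} \<Longrightarrow> h \<in> Y \<Longrightarrow> norm h \<le> \<delta> \<Longrightarrow>
      R (z i - z 0 + h) \<le> R (z i - z 0) + f i h + e' * norm h" by blast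
  obtain m where m: "1 / real (Suc m) < \<delta> / 2" using nat_approx_posE[of "\<delta> / 2"] \<delta> by (metis half_gt_zero)

  \<comment> \<open>change the component i only; beyond distance \<open>\<delta>\<close> the bound \<open>L\<close> on \<open>f i\<close> suffices\<close>
  have normal: "- f i (u - z i) \<le> \<epsilon> * norm (u - z i) + 2 * L * max 0 (norm (u - z i) - 1 / real (Suc m))"
    if i: "i \<in> {1..n}" and u: "u \<in> Y" "u \<in> \<Omega> i" for i u
  proof (cases "norm (u - z i) \<le> \<delta>")
    case True
    have "z(i := u) \<in> M" using z(1) i u by (auto simp: M_def)
    then have "\<Phi> z \<le> \<Phi> (z(i := u)) + e * norm (u - z i)"
      using min[of "z(i := u)"] d_upd[of i z u] i by (simp add: norm_minus_commute)
    moreover have "\<Phi> (z(i := u)) - \<Phi> z = R (u - z 0) - R (z i - z 0)"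
    proof -
      have "\<Phi> (z(i := u)) - \<Phi> z = (\<Sum>j=1..n. R ((z(i := u)) j - z 0) - R (z j - z 0))"
        using i by (simp add: \<Phi>_def sum_subtractf)
      also have "\<dots> = (\<Sum>j\<in>{i}. R ((z(i := u)) j - z 0) - R (z j - z 0))"
        using i by (intro sum.mono_neutral_right) auto
      finally show ?thesis by simp
    qed
    moreover have "R (u - z 0) \<le> R (z i - z 0) + f i (u - z i) + e' * norm (u - z i)"
      using smooth[OF i, of "u - z i"] True subspace_diff[OF Y(1) u(1)] zi[OF i] by simp
    ultimately have "- f i (u - z i) \<le> e * norm (u - z i) + e' * norm (u - z i)" by linarith
    also have "\<dots> = (e + e') * norm (u - z i)" by (simp add: distrib_right)
    also have "\<dots> \<le> \<epsilon> * norm (u - z i)" using e'_le \<epsilon> by (intro mult_right_mono) (auto simp: e_def)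
    also have "\<dots> \<le> \<epsilon> * norm (u - z i) + 2 * L * max 0 (norm (u - z i) - 1 / real (Suc m))" using L by simp
    finally show ?thesis .
  next
    case False
    have "- f i (u - z i) \<le> L * norm (u - z i)" using fabs[of i "u - z i"] by linarith
    also have "\<dots> \<le> L * (2 * max 0 (norm (u - z i) - 1 / real (Suc m)))"
    proof (rule mult_left_mono[OF _ L])
      have "a \<le> 2 * max 0 (a - c)" if "\<not> a \<le> \<delta>" "c < \<delta> / 2" for a c :: real
        using that by (simp add: max_def)
      then show "norm (u - z i) \<le> 2 * max 0 (norm (u - z i) - 1 / real (Suc m))"
        using False m by blast
    qed
    also have "\<dots> \<le> \<epsilon> * norm (u - z i) + 2 * L * max 0 (norm (u - z i) - 1 / real (Suc m))" using \<epsilon> by simp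
    finally show ?thesis .
  qed

  \<comment> \<open>change the component 0 only\<close>
  have balance: "(\<Sum>i=1..n. f i v) \<le> \<epsilon> * norm v" if v: "v \<in> Y" for v
  proof (cases "v = 0")
    case True
    then show ?thesis using linear_0[OF lin] by simp
  next
    case False
    \<comment> \<open>the step keeps within the range of differentiability and, as \<open>\<eta> \<le> r / 2\<close>, within the ball of radius r\<close>
    define t where "t = min \<delta> (r / 2) / norm v"
    have t: "0 < t" using False \<delta> r by (simp add: t_def)
    have tv: "norm (t *\<^sub>R v) = min \<delta> (r / 2)" using False \<delta> r by (simp add: t_def)
    have tvY: "t *\<^sub>R v \<in> Y" using subspace_scale[OF Y(1) v] .
    let ?z = "z(0 := z 0 + t *\<^sub>R v)"
    have "dist (zbar 0) (z 0 + t *\<^sub>R v) \<le> r"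
    proof -
      have "norm ((z 0 - zbar 0) + t *\<^sub>R v) \<le> \<eta> + r / 2"
        using norm_triangle_mono[OF close[of 0], of "t *\<^sub>R v" "r / 2"] tv by simp
      then show ?thesis by (simp add: dist_norm norm_minus_commute \<eta>_def algebra_simps)
    qed
    then have "?z \<in> M" using z(1) subspace_add[OF Y(1) z0 tvY] by (auto simp: M_def)
    then have step: "\<Phi> z \<le> \<Phi> ?z + e * norm (t *\<^sub>R v)"
      using min[of ?z] d_upd[of 0 z "z 0 + t *\<^sub>R v"] by simp
    have "\<Phi> ?z = (\<Sum>i=1..n. R (z i - z 0 + - (t *\<^sub>R v)))"
      unfolding \<Phi>_def by (intro sum.cong) (auto simp: algebra_simps)
    also have "\<dots> \<le> (\<Sum>i=1..n. R (z i - z 0) + f i (- (t *\<^sub>R v)) + e' * norm (- (t *\<^sub>R v)))"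
      using tv subspace_neg[OF Y(1) tvY] by (intro sum_mono smooth) auto
    also have "\<dots> = \<Phi> z - t * (\<Sum>i=1..n. f i v) + real n * e' * norm (t *\<^sub>R v)"
      by (simp add: \<Phi>_def sum.distrib sum_subtractf linear_neg[OF lin] linear_scale[OF lin] sum_negf sum_distrib_left)
    finally have "t * (\<Sum>i=1..n. f i v) \<le> real n * e' * norm (t *\<^sub>R v) + e * norm (t *\<^sub>R v)"
      using step by linarith
    also have "\<dots> = (real n * e' + e) * norm (t *\<^sub>R v)" by (simp only: distrib_right)
    also have "\<dots> = t * ((real n * e' + e) * norm v)" using t by simp
    finally have "(\<Sum>i=1..n. f i v) \<le> (real n * e' + e) * norm v" using t by simp
    also have "\<dots> \<le> \<epsilon> * norm v" using e'_sum \<epsilon> by (intro mult_right_mono) (auto simp: e_def)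
    finally show ?thesis .
  qed

  have "multipliers p n \<Omega> L \<epsilon> (1 / real (Suc m)) z s U f" if "0 < s" "U \<subseteq> Y" for s U
    unfolding multipliers_def
  proof (intro conjI ballI allI)
    show "f i \<in> dominated p" for i by (rule fK)
    show "p (z i - z 0) - \<epsilon> - s \<le> f i (z i - z 0)" for i
      using g(2)[of "z i - z 0"] \<open>0 < s\<close> by (simp add: f_def \<kappa>_def)
    show "- f i (u - z i) \<le> \<epsilon> * norm (u - z i) + 2 * L * max 0 (norm (u - z i) - 1 / real (Suc m)) + s"
      if "i \<in> {1..n}" "u \<in> U \<inter> \<Omega> i" for i u
      using normal[OF that(1), of u] that(2) \<open>U \<subseteq> Y\<close> \<open>0 < s\<close> by fastforce
    show "(\<Sum>i=1..n. f i v) \<le> \<epsilon> * norm v + s" if "v \<in> U" for v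
      using balance[of v] that \<open>U \<subseteq> Y\<close> \<open>0 < s\<close> by fastforce
  qed
  then have "\<exists>f. multipliers p n \<Omega> L \<epsilon> (1 / real (Suc m)) z s U f" if "0 < s" "finite U" for s U
    using that zY by (intro lift) blast+
  then obtain f' where "multipliers p n \<Omega> L \<epsilon> (1 / real (Suc m)) z 0 UNIV f'"
    by (rule multipliers_compactness)
  moreover have "norm (z i - zbar i) \<le> \<epsilon>" if "i \<le> n" for i using close[OF that] by (simp add: \<eta>_def)
  ultimately show thesis using that[of z "1 / real (Suc m)" f'] zi by auto
qed

section \<open>Minkowski gauge, minimal time and projection\<close>

lemma minkowski_gauge_le: "0 \<le> t \<Longrightarrow> x \<in> (*\<^sub>R) t ` F \<Longrightarrow> minkowski_gauge F x \<le> t"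
  unfolding minkowski_gauge_def by (intro cInf_lower bdd_belowI[of _ 0]) auto

lemma minkowski_gauge_greatest:
  assumes "0 \<in> interior F" "\<And>t. 0 \<le> t \<Longrightarrow> x \<in> (*\<^sub>R) t ` F \<Longrightarrow> c \<le> t"
  shows "c \<le> minkowski_gauge F x"
  unfolding minkowski_gauge_def using minkowski_gauge_nonempty[OF assms(1), of x] assms(2)
  by (intro cInf_greatest) auto

lemma sublinear_minkowski_gauge:
  fixes F :: "'a::real_normed_vector set"
  assumes F: "convex F" "0 \<in> interior F"
  shows "sublinear (minkowski_gauge F)"
proof (rule sublinearI)
  let ?p = "minkowski_gauge F"
  note greatest = minkowski_gauge_greatest[OF F(2)]
  have F0: "0 \<in> F" using F(2) interior_subset by blast
  show "?p 0 = 0"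
  proof (rule antisym)
    show "?p 0 \<le> 0" using F0 by (intro minkowski_gauge_le) auto
    show "0 \<le> ?p 0" by (intro greatest)
  qed
  fix x y :: 'a
  have "?p (x + y) \<le> t + s" if t: "0 \<le> t" "x \<in> (*\<^sub>R) t ` F" and s: "0 \<le> s" "y \<in> (*\<^sub>R) s ` F" for t s
  proof (rule minkowski_gauge_le)
    obtain a b where a: "a \<in> F" "x = t *\<^sub>R a" and b: "b \<in> F" "y = s *\<^sub>R b" using t s by auto
    show "x + y \<in> (*\<^sub>R) (t + s) ` F"
    proof (cases "t + s = 0")
      case True
      then have "t = 0" "s = 0" using t(1) s(1) by auto
      then show ?thesis using a b F0 by auto
    next
      case False
      have "(t / (t + s)) *\<^sub>R a + (s / (t + s)) *\<^sub>R b \<in> F"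
        using t(1) s(1) False by (intro convexD[OF F(1) a(1) b(1)]) (auto simp: add_divide_distrib[symmetric])
      moreover have "x + y = (t + s) *\<^sub>R ((t / (t + s)) *\<^sub>R a + (s / (t + s)) *\<^sub>R b)"
        using False by (simp add: a b scaleR_add_right)
      ultimately show ?thesis by blast
    qed
  qed (use t s in simp)
  then have "?p (x + y) - s \<le> ?p x" if "0 \<le> s" "y \<in> (*\<^sub>R) s ` F" for s
    using that by (intro greatest) (simp add: diff_le_eq)
  then have "?p (x + y) - ?p x \<le> ?p y" by (intro greatest) (simp add: algebra_simps)
  then show "?p (x + y) \<le> ?p x + ?p y" by simp
next
  fix t :: real and x :: 'a
  assume t: "0 < t"
  have "minkowski_gauge F (t *\<^sub>R x) / t \<le> minkowski_gauge F x"
  proof (rule minkowski_gauge_greatest[OF F(2)])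
    fix s assume s: "0 \<le> s" "x \<in> (*\<^sub>R) s ` F"
    have "minkowski_gauge F (t *\<^sub>R x) \<le> t * s" using t s by (intro minkowski_gauge_le) auto
    then show "minkowski_gauge F (t *\<^sub>R x) / t \<le> s" using t by (simp add: field_simps)
  qed
  then show "minkowski_gauge F (t *\<^sub>R x) \<le> t * minkowski_gauge F x" using t by (simp add: field_simps)
qed

lemma minkowski_gauge_bound:
  fixes F :: "'a::real_normed_vector set"
  assumes "0 \<in> interior F"
  obtains L where "0 \<le> L" "\<And>x. minkowski_gauge F x \<le> L * norm x"
proof -
  obtain e where e: "0 < e" "cball 0 e \<subseteq> F" using assms by (meson mem_interior_cball)
  show thesis
  proof
    show "0 \<le> 1 / e" using e by simp
    fix x
    show "minkowski_gauge F x \<le> 1 / e * norm x"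
    proof (rule minkowski_gauge_le)
      show "0 \<le> 1 / e * norm x" using e by simp
      have "(e / norm x) *\<^sub>R x \<in> F" using e by (cases "x = 0") (auto simp: subset_iff)
      moreover have "x = (1 / e * norm x) *\<^sub>R ((e / norm x) *\<^sub>R x)" using e by (cases "x = 0") auto
      ultimately show "x \<in> (*\<^sub>R) (1 / e * norm x) ` F" by blast
    qed
  qed
qed

lemma minimal_time_le_gauge:
  assumes "0 \<in> interior F" "w \<in> \<Omega>"
  shows "minimal_time F \<Omega> x \<le> minkowski_gauge F (w - x)"
proof (rule minkowski_gauge_greatest[OF assms(1)])
  fix t assume t: "0 \<le> t" "w - x \<in> (*\<^sub>R) t ` F"
  then have "w \<in> (+) x ` (*\<^sub>R) t ` F" using imageI[OF t(2), of "(+) x"] by simp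
  then show "minimal_time F \<Omega> x \<le> t"
    unfolding minimal_time_def using t(1) assms(2) by (intro cInf_lower bdd_belowI[of _ 0]) auto
qed

lemma gauge_le_minimal_time:
  assumes "0 \<in> interior F" "w \<in> gen_projection F \<Omega> x"
  shows "minkowski_gauge F (w - x) \<le> minimal_time F \<Omega> x"
proof (rule minkowski_gauge_le)
  have "\<Omega> \<noteq> {}" using assms(2) by (auto simp: gen_projection_def)
  then show "0 \<le> minimal_time F \<Omega> x"
    unfolding minimal_time_def using minimal_time_nonempty[OF assms(1)] by (intro cInf_greatest) auto
  show "w - x \<in> (*\<^sub>R) (minimal_time F \<Omega> x) ` F" using assms(2) by (auto simp: gen_projection_def)
qed

lemma gen_projection_self:
  assumes "0 \<in> F" "x \<in> \<Omega>"
  shows "x \<in> gen_projection F \<Omega> x"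
proof -
  have "x \<in> (+) x ` (*\<^sub>R) 0 ` F" using assms(1) by force
  then have "0 \<in> {t. 0 \<le> t \<and> \<Omega> \<inter> ((+) x ` ((*\<^sub>R) t ` F)) \<noteq> {}}" using assms(2) by blast
  then have "minimal_time F \<Omega> x = 0"
    unfolding minimal_time_def by (intro cInf_eq_minimum) auto
  then show ?thesis using \<open>x \<in> (+) x ` (*\<^sub>R) 0 ` F\<close> assms(2) by (simp add: gen_projection_def)
qed

lemma well_posed_imp_projection_nonempty:
  assumes "well_posed_at F \<Omega> x"
  shows "gen_projection F \<Omega> x \<noteq> {}"
proof -
  have "\<exists>w. \<forall>k :: nat. w k \<in> gen_projection F \<Omega> x"
    using assms[unfolded well_posed_at_def, rule_format, of "\<lambda>_. x"] by auto
  then show ?thesis by blast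
qed

section \<open>Passage to the limit\<close>

lemma dominated_blinfun_apply:
  fixes p :: "'a::real_normed_vector \<Rightarrow> real"
  assumes "f \<in> dominated p" "\<And>x. p x \<le> L * norm x"
  shows "blinfun_apply (Blinfun f) = f"
proof (rule bounded_linear_Blinfun_apply)
  have lin: "linear f" using assms(1) by (simp add: dominated_def)
  show "bounded_linear f"
  proof (rule bounded_linear_intro)
    show "norm (f x) \<le> norm x * L" for x
      using dominated_abs_le[OF assms, of x] by (simp add: mult.commute)
  qed (use lin in \<open>simp_all add: linear_add linear_scale\<close>)
qed

text \<open>Within distance \<open>\<delta>\<close> of \<open>z i\<close> the term with \<open>2 * L\<close> is 0.\<close>

lemma multipliers_eps_normal:
  fixes p :: "'a::real_normed_vector \<Rightarrow> real"
  assumes m: "multipliers p n \<Omega> L \<epsilon> \<delta> z 0 UNIV f" and \<delta>: "0 < \<delta>"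
    and p: "\<And>x. p x \<le> L * norm x" and i: "i \<in> {1..n}" and zi: "z i \<in> \<Omega> i"
  shows "- Blinfun (f i) \<in> eps_normals \<epsilon> (z i) (\<Omega> i)"
proof -
  have fi: "f i \<in> dominated p" using m by (simp add: multipliers_def)
  have app: "blinfun_apply (Blinfun (f i)) = f i" by (rule dominated_blinfun_apply[OF fi]) (rule p)
  have "eventually (\<lambda>u. ereal (- f i (u - z i) / norm (u - z i)) \<le> ereal \<epsilon>) (at (z i) within \<Omega> i)"
    unfolding eventually_at
  proof (intro exI conjI ballI impI)
    show "0 < \<delta>" by fact
    fix u assume u: "u \<in> \<Omega> i" "u \<noteq> z i \<and> dist u (z i) < \<delta>"
    then have "max 0 (norm (u - z i) - \<delta>) = 0" by (simp add: dist_norm)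
    moreover have "- f i (u - z i) \<le> \<epsilon> * norm (u - z i) + 2 * L * max 0 (norm (u - z i) - \<delta>) + 0"
      using m i u unfolding multipliers_def by blast
    ultimately have "- f i (u - z i) \<le> \<epsilon> * norm (u - z i)" by simp
    moreover have "0 < norm (u - z i)" using u(2) by simp
    ultimately have "- f i (u - z i) / norm (u - z i) \<le> \<epsilon>" using pos_divide_le_eq by blast
    then show "ereal (- f i (u - z i) / norm (u - z i)) \<le> ereal \<epsilon>" by simp
  qed
  then have "Limsup (at (z i) within \<Omega> i) (\<lambda>u. ereal (- f i (u - z i) / norm (u - z i))) \<le> ereal \<epsilon>"
    by (rule Limsup_bounded)
  then show ?thesis using zi by (simp add: eps_normals_def app blinfun.minus_left)
qed

lemma dominated_convergent_subsequence_finite: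
  fixes f :: "nat \<Rightarrow> nat \<Rightarrow> 'a::banach \<Rightarrow> real"
  assumes asplund: "asplund_space TYPE('a)"
    and p: "\<And>x. p x \<le> L * norm x"
    and f: "\<And>k i. f k i \<in> dominated p"
  shows "\<exists>r g. strict_mono r \<and> (\<forall>i\<in>{1..n}. g i \<in> dominated p \<and> (\<forall>v. (\<lambda>k. f (r k) i v) \<longlonglongrightarrow> g i v))"
proof (induction n)
  case 0
  show ?case by (intro exI[of _ id]) (auto simp: strict_mono_def)
next
  case (Suc n)
  then obtain r g where r: "strict_mono r"
    and g: "\<And>i. i \<in> {1..n} \<Longrightarrow> g i \<in> dominated p \<and> (\<forall>v. (\<lambda>k. f (r k) i v) \<longlonglongrightarrow> g i v)" by blast
  obtain r' h where r': "strict_mono r'" and h: "h \<in> dominated p" "\<And>v. (\<lambda>k. f (r (r' k)) (Suc n) v) \<longlonglongrightarrow> h v"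
    by (rule dominated_convergent_subsequence[OF asplund, where p = p and L = L and f = "\<lambda>k. f (r k) (Suc n)", OF p f])
      (rule that)
  show ?case
  proof (intro exI conjI ballI allI)
    show "strict_mono (r \<circ> r')" using r r' by (rule strict_mono_o)
    fix i assume i: "i \<in> {1..Suc n}"
    show "(g(Suc n := h)) i \<in> dominated p" using g h i by (cases "i = Suc n") auto
    fix v
    show "(\<lambda>k. f ((r \<circ> r') k) i v) \<longlonglongrightarrow> (g(Suc n := h)) i v"
    proof (cases "i = Suc n")
      case False
      then have "(\<lambda>k. f (r k) i v) \<longlonglongrightarrow> g i v" using g i by auto
      from LIMSEQ_subseq_LIMSEQ[OF this r'] show ?thesis using False by (simp add: o_def)
    qed (use h in simp)
  qed
qed

theorem theorem4p2:
  fixes F :: "'a::banach set" and \<Omega> :: "nat \<Rightarrow> 'a set" and n :: nat and xbar :: 'a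
  assumes "asplund_space TYPE('a)"
    and "F \<noteq> {}" "closed F" "bounded F" "convex F" "0 \<in> interior F"
    and "n \<ge> 1"
    and "\<And>i. i \<in> {1..n} \<Longrightarrow> \<Omega> i \<noteq> {}"
    and "\<And>i. i \<in> {1..n} \<Longrightarrow> closed (\<Omega> i)"
    and "local_minimizer (\<lambda>x. \<Sum>i=1..n. minimal_time F (\<Omega> i) x) xbar"
    and "\<And>i. i \<in> {1..n} \<Longrightarrow> xbar \<notin> \<Omega> i \<Longrightarrow> well_posed_at F (\<Omega> i) xbar"
  shows "0 \<in> (\<Sum>i=1..n. FT_set F (\<Omega> i) xbar)"
proof -
  let ?p = "minkowski_gauge F"
  have F0: "0 \<in> F" using assms(6) interior_subset by blast
  have sub: "sublinear ?p" using assms(5,6) by (rule sublinear_minkowski_gauge)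
  obtain L where L: "0 \<le> L" and p: "\<And>x. ?p x \<le> L * norm x"
    using minkowski_gauge_bound[OF assms(6)] by blast

  have "\<exists>w. w \<in> gen_projection F (\<Omega> i) xbar" if "i \<in> {1..n}" for i
    using gen_projection_self[OF F0] well_posed_imp_projection_nonempty assms(11)[OF that] by blast
  then obtain w where w: "\<And>i. i \<in> {1..n} \<Longrightarrow> w i \<in> gen_projection F (\<Omega> i) xbar" by metis
  \<comment> \<open>the component 0 carries the variable point x\<close>
  define zbar where "zbar = w(0 := xbar)"
  have zbar0: "zbar 0 = xbar" and zbar_i: "zbar i = w i" if "i \<in> {1..n}" for i
    using that by (auto simp: zbar_def)
  have zbar_\<Omega>: "zbar i \<in> \<Omega> i" if "i \<in> {1..n}" for i
    using w[OF that] zbar_i[OF that] by (simp add: gen_projection_def)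
  obtain r where r: "0 < r" and opt: "\<And>y. y \<in> ball xbar r \<Longrightarrow>
      (\<Sum>i=1..n. minimal_time F (\<Omega> i) xbar) \<le> (\<Sum>i=1..n. minimal_time F (\<Omega> i) y)"
    using assms(10) unfolding local_minimizer_def by blast
  have opt': "(\<Sum>i=1..n. ?p (zbar i - zbar 0)) \<le> (\<Sum>i=1..n. ?p (z i - z 0))"
    if "norm (z 0 - zbar 0) \<le> r / 2" "\<And>i. i \<in> {1..n} \<Longrightarrow> z i \<in> \<Omega> i" for z
  proof -
    have "(\<Sum>i=1..n. ?p (zbar i - zbar 0)) \<le> (\<Sum>i=1..n. minimal_time F (\<Omega> i) xbar)"
      using gauge_le_minimal_time[OF assms(6)] w by (intro sum_mono) (simp add: zbar_def)
    also have "\<dots> \<le> (\<Sum>i=1..n. minimal_time F (\<Omega> i) (z 0))"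
      using that(1) r by (intro opt) (simp add: zbar_def dist_norm norm_minus_commute)
    also have "\<dots> \<le> (\<Sum>i=1..n. ?p (z i - z 0))"
      using that(2) by (intro sum_mono minimal_time_le_gauge[OF assms(6)])
    finally show ?thesis .
  qed

  define \<epsilon> where "\<epsilon> k = 1 / real (Suc k)" for k
  have \<epsilon>: "0 < \<epsilon> k" for k by (simp add: \<epsilon>_def)
  have \<epsilon>_lim: "\<epsilon> \<longlonglongrightarrow> 0" unfolding \<epsilon>_def by (rule lim_1_over_n[THEN LIMSEQ_Suc])
  have "\<exists>z f \<delta>. (\<forall>i\<le>n. norm (z i - zbar i) \<le> \<epsilon> k) \<and> (\<forall>i\<in>{1..n}. z i \<in> \<Omega> i) \<and> 0 < \<delta> \<and>
      multipliers ?p n \<Omega> L (\<epsilon> k) \<delta> z 0 UNIV f" for k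
  proof -
    obtain z f \<delta> where "\<And>i. i \<le> n \<Longrightarrow> norm (z i - zbar i) \<le> \<epsilon> k" "\<And>i. i \<in> {1..n} \<Longrightarrow> z i \<in> \<Omega> i"
      "0 < \<delta>" "multipliers ?p n \<Omega> L (\<epsilon> k) \<delta> z 0 UNIV f"
    proof (rule approximate_multipliers[OF assms(1) sub, where L = L and n = n and \<Omega> = \<Omega>
          and zbar = zbar and r = "r / 2" and \<epsilon> = "\<epsilon> k"])
      show "?p x \<le> L * norm x" for x by (rule p)
      show "closed (\<Omega> i)" if "i \<in> {1..n}" for i using that by (rule assms(9))
      show "zbar i \<in> \<Omega> i" if "i \<in> {1..n}" for i using that by (rule zbar_\<Omega>)
      show "(\<Sum>i=1..n. ?p (zbar i - zbar 0)) \<le> (\<Sum>i=1..n. ?p (z i - z 0))"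
        if "norm (z 0 - zbar 0) \<le> r / 2" "\<And>i. i \<in> {1..n} \<Longrightarrow> z i \<in> \<Omega> i" for z
        using that by (rule opt')
      show "0 \<le> L" "0 < r / 2" "0 < \<epsilon> k" using L r \<epsilon> by simp_all
    qed (rule that)
    then show ?thesis by (intro exI[of _ z] exI[of _ f] exI[of _ \<delta>]) simp
  qed
  then obtain z f \<delta> where z: "\<And>k i. i \<le> n \<Longrightarrow> norm (z k i - zbar i) \<le> \<epsilon> k"
    and z\<Omega>: "\<And>k i. i \<in> {1..n} \<Longrightarrow> z k i \<in> \<Omega> i" and \<delta>: "\<And>k. 0 < \<delta> k"
    and m: "\<And>k. multipliers ?p n \<Omega> L (\<epsilon> k) (\<delta> k) (z k) 0 UNIV (f k)"
    by metis
  have fK: "f k i \<in> dominated ?p" for k i using m by (simp add: multipliers_def)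
  have "\<exists>s g. strict_mono s \<and>
      (\<forall>i\<in>{1..n}. g i \<in> dominated ?p \<and> (\<forall>v. (\<lambda>k. f (s k) i v) \<longlonglongrightarrow> g i v))"
    by (rule dominated_convergent_subsequence_finite[OF assms(1), where p = ?p and L = L])
      (fact p fK)+
  then obtain s g where s: "strict_mono s" and gK: "\<And>i. i \<in> {1..n} \<Longrightarrow> g i \<in> dominated ?p"
    and lim: "\<And>i v. i \<in> {1..n} \<Longrightarrow> (\<lambda>k. f (s k) i v) \<longlonglongrightarrow> g i v"
    by blast
  have \<epsilon>s: "(\<lambda>k. \<epsilon> (s k)) \<longlonglongrightarrow> 0" using LIMSEQ_subseq_LIMSEQ[OF \<epsilon>_lim s] by (simp add: o_def)
  have app: "blinfun_apply (Blinfun (g i)) = g i" if "i \<in> {1..n}" for i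
    by (rule dominated_blinfun_apply[OF gK[OF that]]) (rule p)
  have appf: "blinfun_apply (Blinfun (f k i)) = f k i" for k i
    by (rule dominated_blinfun_apply[OF fK]) (rule p)

  have active: "?p (w i - xbar) \<le> g i (w i - xbar)" if i: "i \<in> {1..n}" for i
  proof (rule LIMSEQ_le)
    \<comment> \<open>the multipliers for the tuple z k serve for zbar with this slack\<close>
    let ?t = "\<lambda>k. (3 * L + \<epsilon> k) * (real (Suc n) * \<epsilon> k)"
    have "multipliers ?p n \<Omega> L (\<epsilon> k) (\<delta> k) zbar (?t k) UNIV (f k)" for k
    proof (rule multipliers_perturb[OF sub _ L less_imp_le[OF \<epsilon>] m])
      have "(\<Sum>i\<le>n. norm (z k i - zbar i)) \<le> (\<Sum>i\<le>n. \<epsilon> k)" using z by (intro sum_mono) simp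
      then show "0 + (3 * L + \<epsilon> k) * (\<Sum>i\<le>n. norm (z k i - zbar i)) \<le> ?t k"
        using L \<epsilon>[of k] by (simp add: mult_left_mono)
    qed (rule p)
    then have *: "?p (w i - xbar) - \<epsilon> k - ?t k \<le> f k i (w i - xbar)" for k
      using i zbar0 zbar_i[OF i] unfolding multipliers_def by metis
    show "(\<lambda>k. ?p (w i - xbar) - \<epsilon> (s k) - ?t (s k)) \<longlonglongrightarrow> ?p (w i - xbar)"
      by (rule tendsto_eq_intros \<epsilon>s refl | simp)+
    show "\<exists>N. \<forall>k\<ge>N. ?p (w i - xbar) - \<epsilon> (s k) - ?t (s k) \<le> f (s k) i (w i - xbar)" using * by blast
  qed (rule lim[OF i])

  have subgrad: "Blinfun (g i) \<in> convex_subdifferential ?p (w i - xbar)" if i: "i \<in> {1..n}" for i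
  proof -
    have "g i (x - (w i - xbar)) \<le> ?p x - ?p (w i - xbar)" for x
    proof -
      have "linear (g i)" "g i x \<le> ?p x" using gK[OF i] by (auto simp: dominated_def)
      then show ?thesis using active[OF i] by (simp add: linear_diff)
    qed
    then show ?thesis by (simp add: convex_subdifferential_def app[OF i])
  qed

  have normal: "- Blinfun (g i) \<in> normal_cone (w i) (\<Omega> i)" if i: "i \<in> {1..n}" for i
    unfolding normal_cone_def
  proof (intro CollectI exI conjI allI)
    show "decseq (\<lambda>k. \<epsilon> (s k))"
      unfolding decseq_def \<epsilon>_def using strict_mono_leD[OF s] by (auto intro!: divide_left_mono)
    show "(\<lambda>k. \<epsilon> (s k)) \<longlonglongrightarrow> 0" by (rule \<epsilon>s)
    show "(\<lambda>k. z (s k) i) \<longlonglongrightarrow> w i"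
    proof (rule LIM_zero_cancel, rule Lim_null_comparison[OF _ \<epsilon>s])
      show "eventually (\<lambda>k. norm (z (s k) i - w i) \<le> \<epsilon> (s k)) sequentially"
        using z[of i] i zbar_i[OF i] by simp
    qed
    show "- Blinfun (f (s k) i) \<in> eps_normals (\<epsilon> (s k)) (z (s k) i) (\<Omega> i)" for k
      by (rule multipliers_eps_normal[OF m \<delta> _ i z\<Omega>[OF i]]) (rule p)
    show "limitin weak_star_topology (\<lambda>k. - Blinfun (f (s k) i)) (- Blinfun (g i)) sequentially"
      unfolding limitin_weak_star_iff blinfun.minus_left appf app[OF i]
      by (intro allI tendsto_minus lim i)
  qed

  have le0: "(\<Sum>i=1..n. g i v) \<le> 0" for v
  proof (rule LIMSEQ_le)
    show "(\<lambda>k. \<Sum>i=1..n. f (s k) i v) \<longlonglongrightarrow> (\<Sum>i=1..n. g i v)" by (intro tendsto_sum lim)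
    show "(\<lambda>k. \<epsilon> (s k) * norm v) \<longlonglongrightarrow> 0" using tendsto_mult_right[OF \<epsilon>s, of "norm v"] by simp
    show "\<exists>N. \<forall>k\<ge>N. (\<Sum>i=1..n. f (s k) i v) \<le> \<epsilon> (s k) * norm v" using m by (simp add: multipliers_def)
  qed
  have "(\<Sum>i=1..n. g i v) = 0" for v
  proof -
    have "g i (- v) = - g i v" if "i \<in> {1..n}" for i using gK[OF that] by (auto simp: dominated_def linear_neg)
    then have "(\<Sum>i=1..n. g i (- v)) = - (\<Sum>i=1..n. g i v)" by (simp add: sum_negf)
    then show ?thesis using le0[of v] le0[of "- v"] by simp
  qed
  then have "0 = (\<Sum>i=1..n. - Blinfun (g i))"
    by (intro blinfun_eqI) (simp add: blinfun.sum_left blinfun.minus_left app sum_negf)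
  moreover have "- Blinfun (g i) \<in> FT_set F (\<Omega> i) xbar" if "i \<in> {1..n}" for i
    using w[OF that] subgrad[OF that] normal[OF that] unfolding FT_set_def by blast
  ultimately show ?thesis unfolding set_sum_alt[OF finite_atLeastAtMost] by blast
qed

end
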